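(* Let $A$ be an integer weighing matrix with $$A\sim_H A_1^{\oplus r_1}\oplus A_2^{\oplus r_2}\oplus\cdots\oplus A_s^{\oplus r_s},$$ where the $A_i$ are primitive integer weighing matrices and $A_i$, $A_j$ are not H-equivalent for $i\neq j$. Then $$\mathrm{Aut}(A)\cong\prod_{t=1}^s \mathrm{Aut}(A_t)\wr S_{r_t}.$$ In particular $|\mathrm{Aut}(A)|=\prod_{t=1}^s|\mathrm{Aut}(A_t)|^{r_t}\,r_t!$.
   Context: An integer weighing matrix is a square integer matrix $A$ with $AA^\top=kI$ for some integer $k$. $\mathrm{Mon}(n)$ is the set of $n\times n$ monomial matrices with entries in $\{0,\pm1\}$. $A\sim_H B$ means $B=LAR^\top$ with $L,R$ monomial. $\mathrm{Aut}(A)=\{(L,R)\in\mathrm{Mon}(n)^2: LAR^\top=A\}$, a group under componentwise multiplication. $X^{\oplus r}$ is the block diagonal sum of $r$ copies of $X$. A primitive integer weighing matrix is one not H-equivalent to a block diagonal sum of two or more smaller square blocks. For a group $H$, $H\wr S_r$ is the semidirect product $H^r\rtimes S_r$ with $S_r$ permuting the coordinates.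
   Formalization: Integer weighing matrices are taken of order n ≥ 1 and with k ≠ 0, which excludes zero and empty matrices; for k = 0 the claim fails, e.g. the 2×2 zero matrix [0]⊕[0] has 64 automorphisms while the formula gives 32. *)

theory Defs
  imports
    "Jordan_Normal_Form.Matrix"
    "HOL-Algebra.Product_Groups"
    "HOL-Algebra.Sym_Groups"
begin

(* The order is taken positive and the weight k nonzero. For n >= 1, A * A^T = kI forces k >= 0,
   and k = 0 only for A = 0, so the zero matrices (and the empty matrix) are all that is excluded.
   Both are degenerate: Aut(0_n) is Mon(n) x Mon(n), although 0_n is a direct sum of n copies
   of 0_1, and the empty matrix is a direct sum of any number of copies of itself. *)
definition int_weighing_mat :: "int mat \<Rightarrow> bool" where
  "int_weighing_mat A \<longleftrightarrow>
     (\<exists>n>0. A \<in> carrier_mat n n \<and> (\<exists>k. k \<noteq> 0 \<and> A * A\<^sup>T = k \<cdot>\<^sub>m 1\<^sub>m n))"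

definition Mon :: "nat \<Rightarrow> int mat set" where
  "Mon n = {M \<in> carrier_mat n n.
     (\<forall>i<n. \<forall>j<n. M $$ (i, j) \<in> {-1, 0, 1}) \<and>
     (\<forall>i<n. \<exists>!j. j < n \<and> M $$ (i, j) \<noteq> 0) \<and>
     (\<forall>j<n. \<exists>!i. i < n \<and> M $$ (i, j) \<noteq> 0)}"

definition H_equiv :: "int mat \<Rightarrow> int mat \<Rightarrow> bool" (infix "\<sim>\<^sub>H" 50) where
  "A \<sim>\<^sub>H B \<longleftrightarrow> (\<exists>L \<in> Mon (dim_row A). \<exists>R \<in> Mon (dim_col A). B = L * A * R\<^sup>T)"

definition primitive_int_weighing_mat :: "int mat \<Rightarrow> bool" where
  "primitive_int_weighing_mat A \<longleftrightarrow> int_weighing_mat A \<and>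
     \<not> (\<exists>Bs. length Bs \<ge> 2 \<and> (\<forall>B \<in> set Bs. square_mat B \<and> dim_row B < dim_row A) \<and>
            A \<sim>\<^sub>H diag_block_mat Bs)"

definition Aut_mat :: "int mat \<Rightarrow> (int mat \<times> int mat) monoid" where
  "Aut_mat A =
     \<lparr>carrier = {(L, R). L \<in> Mon (dim_row A) \<and> R \<in> Mon (dim_col A) \<and> L * A * R\<^sup>T = A},
      mult = (\<lambda>(L, R) (L', R'). (L * L', R * R')),
      one = (1\<^sub>m (dim_row A), 1\<^sub>m (dim_col A))\<rparr>"

definition semidirect_product ::
    "('a, 'c) monoid_scheme \<Rightarrow> ('b, 'd) monoid_scheme \<Rightarrow> ('b \<Rightarrow> 'a \<Rightarrow> 'a) \<Rightarrow> ('a \<times> 'b) monoid" where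
  "semidirect_product N Q \<phi> =
     \<lparr>carrier = carrier N \<times> carrier Q,
      mult = (\<lambda>(n, q) (n', q'). (n \<otimes>\<^bsub>N\<^esub> \<phi> q n', q \<otimes>\<^bsub>Q\<^esub> q')),
      one = (\<one>\<^bsub>N\<^esub>, \<one>\<^bsub>Q\<^esub>)\<rparr>"

(* The inverse makes permuting the coordinates a left action of the symmetric group,
   whose multiplication is composition. *)
definition wreath_sym ::
    "('a, 'c) monoid_scheme \<Rightarrow> nat \<Rightarrow> ((nat \<Rightarrow> 'a) \<times> (nat \<Rightarrow> nat)) monoid" where
  "wreath_sym H r =
     semidirect_product (product_group {1..r} (\<lambda>_. H)) (sym_group r)
       (\<lambda>\<sigma> h. \<lambda>i\<in>{1..r}. h (Hilbert_Choice.inv \<sigma> i))"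

end

(* Defs comes last so that the name order denotes the order of a group, not of a polynomial root. *)
theory Submission
  imports "Jordan_Normal_Form.Determinant" Defs
begin

text \<open>
  The group \<open>Mon n\<close> is the integral orthogonal group: an integer row of norm 1 is plus or minus a unit
  vector. Primitivity of a weighing matrix means that the bipartite graph of its nonzero entries is
  connected; a union of components has equally many rows and columns because all rows and all
  columns have the same norm. An automorphism \<open>(L, R)\<close> of a direct sum of primitive blocks preserves
  the graph of nonzero entries, so \<open>L\<close> and \<open>R\<close> permute the blocks by one and the same permutation.
  Their restrictions exhibit a block and its image as H-equivalent, so only copies of the same
  \<open>B t\<close> are interchanged, and after that each block is acted on by an element of \<open>Aut (B t)\<close>.
\<close>

section \<open>Monomial matrices\<close>

text \<open>Two obstacles shape the proof. Entries of a direct sum sit at offsets that depend on all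
  earlier blocks; a single bijection \<open>e\<close> turns a position into a pair of a block label
  and an index inside the block, after which no offset occurs. Labels, unlike blocks, are distinct,
  so equal copies of one matrix can be told apart and permuted. Secondly, \<open>L\<close> and
  \<open>R\<close> are a priori unrelated. Rewriting invariance of the direct sum \<open>D\<close>
  as \<open>D * R = L * D\<close> ties them together: since monomial matrices have one nonzero entry
  per row and column, each entry of either side is a single product. Membership in
  \<open>Mon\<close> is tested as orthogonality, an identity between matrices that passes to
  products, transposes and blocks by algebra alone. The isomorphism is built from the product of
  wreath products towards the automorphism group, the direction in which it is given by a
  formula.\<close>

lemma gram_transpose:
  fixes A :: "int mat"
  assumes A: "A \<in> carrier_mat n n" and k: "k \<noteq> 0" and eq: "A * A\<^sup>T = k \<cdot>\<^sub>m 1\<^sub>m n"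
  shows "A\<^sup>T * A = k \<cdot>\<^sub>m 1\<^sub>m n"
proof -
  \<comment> \<open>\<open>k\<close> need not be invertible in the integers, whereas over the
    rationals the transpose divided by \<open>k\<close> is a right inverse of a square matrix and
    therefore also a left one.\<close>
  let ?h = "of_int :: int \<Rightarrow> rat"
  let ?B = "map_mat ?h A"
  have B: "?B \<in> carrier_mat n n" using A by simp
  have "?B * ?B\<^sup>T = map_mat ?h (A * A\<^sup>T)"
    using A by (simp add: of_int_hom.mat_hom_mult[of _ n n _ n] map_mat_transpose)
  also have "\<dots> = ?h k \<cdot>\<^sub>m 1\<^sub>m n"
    unfolding eq by (intro eq_matI) auto
  finally have "?B * ((1 / ?h k) \<cdot>\<^sub>m ?B\<^sup>T) = 1\<^sub>m n"
    using B k by (simp add: mult_smult_distrib[of _ n n]) (intro eq_matI, auto)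
  then have "((1 / ?h k) \<cdot>\<^sub>m ?B\<^sup>T) * ?B = 1\<^sub>m n"
    using B mat_mult_left_right_inverse[of ?B n] by simp
  then have "(1 / ?h k) \<cdot>\<^sub>m (?B\<^sup>T * ?B) = 1\<^sub>m n"
    using B by (simp add: mult_smult_assoc_mat[of _ n n _ n])
  then have "?h k \<cdot>\<^sub>m ((1 / ?h k) \<cdot>\<^sub>m (?B\<^sup>T * ?B)) = ?h k \<cdot>\<^sub>m 1\<^sub>m n" by simp
  moreover have "?h k \<cdot>\<^sub>m ((1 / ?h k) \<cdot>\<^sub>m (?B\<^sup>T * ?B)) = ?B\<^sup>T * ?B"
    using k by (intro eq_matI) auto
  moreover have "?B\<^sup>T * ?B = map_mat ?h (A\<^sup>T * A)"
    using A by (simp add: of_int_hom.mat_hom_mult[of _ n n _ n] map_mat_transpose)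
  moreover have "?h k \<cdot>\<^sub>m 1\<^sub>m n = map_mat ?h (k \<cdot>\<^sub>m 1\<^sub>m n)"
    by (intro eq_matI) auto
  ultimately have "map_mat ?h (A\<^sup>T * A) = map_mat ?h (k \<cdot>\<^sub>m 1\<^sub>m n)" by simp
  then show ?thesis by (rule of_int_hom.mat_hom_inj)
qed

lemma mult_transpose_index:
  assumes "A \<in> carrier_mat n m" "B \<in> carrier_mat n' m" "i < n" "j < n'"
  shows "(A * B\<^sup>T) $$ (i, j) = (\<Sum>c<m. A $$ (i, c) * B $$ (j, c))"
  using assms by (auto simp: scalar_prod_def atLeast0LessThan intro!: sum.cong)

text \<open>A nonzero integer has square at least 1, so one nonzero term exhausts the sum and all
  others vanish. Integrality is essential: over the rationals (3/5, 4/5) also has norm 1.\<close>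

lemma int_sum_squares_eq_1:
  fixes f :: "'a \<Rightarrow> int"
  assumes fin: "finite S" and sum: "(\<Sum>j\<in>S. f j * f j) = 1"
  shows "(\<forall>j\<in>S. f j \<in> {-1, 0, 1}) \<and> (\<exists>!j. j \<in> S \<and> f j \<noteq> 0)"
proof -
  have "\<exists>j\<in>S. f j \<noteq> 0"
  proof (rule ccontr)
    assume "\<not> ?thesis"
    then have "(\<Sum>j\<in>S. f j * f j) = 0" by (intro sum.neutral) auto
    with sum show False by simp
  qed
  then obtain j where j: "j \<in> S" "f j \<noteq> 0" by blast
  have "0 < f j * f j" using j by (auto simp: zero_less_mult_iff)
  then have sq: "f j * f j \<ge> 1" by linarith
  have split: "(\<Sum>i\<in>S. f i * f i) = f j * f j + (\<Sum>i\<in>S - {j}. f i * f i)"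
    using j fin by (simp add: sum.remove)
  moreover have nn: "(\<Sum>i\<in>S - {j}. f i * f i) \<ge> 0" by (intro sum_nonneg) auto
  ultimately have fj: "f j * f j = 1" and rest: "(\<Sum>i\<in>S - {j}. f i * f i) = 0"
    using sq sum by linarith+
  have zero: "f i = 0" if "i \<in> S" "i \<noteq> j" for i
    using rest fin that by (subst (asm) sum_nonneg_eq_0_iff) auto
  have "f j = 1 \<or> f j = -1" using fj by (simp add: square_eq_1_iff)
  with zero j show ?thesis by auto
qed

lemma Mon_orthogonal:
  assumes "M \<in> Mon n"
  shows "M * M\<^sup>T = 1\<^sub>m n"
proof (rule eq_matI)
  have carr: "M \<in> carrier_mat n n"
    and entries: "\<And>i j. i < n \<Longrightarrow> j < n \<Longrightarrow> M $$ (i, j) \<in> {-1, 0, 1}"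
    and rows: "\<And>i. i < n \<Longrightarrow> \<exists>!j. j < n \<and> M $$ (i, j) \<noteq> 0"
    and cols: "\<And>j. j < n \<Longrightarrow> \<exists>!i. i < n \<and> M $$ (i, j) \<noteq> 0"
    using assms by (auto simp: Mon_def)
  fix i j assume "i < dim_row (1\<^sub>m n :: int mat)" "j < dim_col (1\<^sub>m n :: int mat)"
  then have ij: "i < n" "j < n" by auto
  have idx: "(M * M\<^sup>T) $$ (i, j) = (\<Sum>c<n. M $$ (i, c) * M $$ (j, c))"
    using carr carr ij by (rule mult_transpose_index)
  show "(M * M\<^sup>T) $$ (i, j) = 1\<^sub>m n $$ (i, j)"
  proof (cases "i = j")
    case True
    obtain c where c: "c < n" "M $$ (i, c) \<noteq> 0" "\<And>c'. c' < n \<Longrightarrow> M $$ (i, c') \<noteq> 0 \<Longrightarrow> c' = c"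
      using rows[OF ij(1)] by metis
    have "(\<Sum>x<n. M $$ (i, x) * M $$ (i, x)) = (\<Sum>x\<in>{c}. M $$ (i, x) * M $$ (i, x))"
    proof (rule sum.mono_neutral_right)
      show "\<forall>x\<in>{..<n} - {c}. M $$ (i, x) * M $$ (i, x) = 0" using c(3) by force
    qed (use c(1) in auto)
    also have "\<dots> = 1"
      using entries[OF ij(1) c(1)] c(2) by auto
    finally show ?thesis using idx ij True by simp
  next
    case False
    have "M $$ (i, c) * M $$ (j, c) = 0" if "c < n" for c
      using cols[OF that] ij False by (metis mult_eq_0_iff)
    then have "(\<Sum>c<n. M $$ (i, c) * M $$ (j, c)) = 0" by (intro sum.neutral) blast
    then show ?thesis using idx ij False by simp
  qed
qed (use assms in \<open>auto simp: Mon_def\<close>)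

lemma orthogonal_transpose:
  fixes M :: "int mat"
  assumes "M \<in> carrier_mat n n" "M * M\<^sup>T = 1\<^sub>m n"
  shows "M\<^sup>T * M = 1\<^sub>m n"
proof -
  have "M * M\<^sup>T = 1 \<cdot>\<^sub>m 1\<^sub>m n" using assms(2) by auto
  from gram_transpose[OF assms(1) _ this] show ?thesis by auto
qed

text \<open>Integer rows of norm 1 are signed unit vectors; the same applied to the transpose gives
  the column condition. This trades the entrywise clauses of \<open>Mon\<close> for one matrix
  identity.\<close>

lemma Mon_iff_orthogonal: "M \<in> Mon n \<longleftrightarrow> M \<in> carrier_mat n n \<and> M * M\<^sup>T = 1\<^sub>m n"
proof
  assume "M \<in> Mon n"
  then show "M \<in> carrier_mat n n \<and> M * M\<^sup>T = 1\<^sub>m n"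
    using Mon_orthogonal by (auto simp: Mon_def)
next
  assume *: "M \<in> carrier_mat n n \<and> M * M\<^sup>T = 1\<^sub>m n"
  have unit_rows: "(\<forall>j<n. N $$ (i, j) \<in> {-1, 0, 1}) \<and> (\<exists>!j. j < n \<and> N $$ (i, j) \<noteq> 0)"
    if "N \<in> carrier_mat n n" "N * N\<^sup>T = 1\<^sub>m n" "i < n" for N :: "int mat" and i
  proof -
    have "(\<Sum>c<n. N $$ (i, c) * N $$ (i, c)) = 1"
      using mult_transpose_index[OF that(1,1,3,3)] that by simp
    from int_sum_squares_eq_1[OF _ this] show ?thesis by simp
  qed
  have "M\<^sup>T * M\<^sup>T\<^sup>T = 1\<^sub>m n" using * orthogonal_transpose[of M n] by simp
  then have cols: "(\<exists>!i. i < n \<and> M\<^sup>T $$ (j, i) \<noteq> 0)" if "j < n" for j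
    using unit_rows[of "M\<^sup>T" j] * that by auto
  have "\<exists>!i. i < n \<and> M $$ (i, j) \<noteq> 0" if "j < n" for j
  proof -
    have "(i < n \<and> M\<^sup>T $$ (j, i) \<noteq> 0) = (i < n \<and> M $$ (i, j) \<noteq> 0)" for i
      using * that by auto
    with cols[OF that] show ?thesis by simp
  qed
  with unit_rows[of M] * show "M \<in> Mon n" by (auto simp: Mon_def)
qed

lemma Mon_carrier: "M \<in> Mon n \<Longrightarrow> M \<in> carrier_mat n n"
  by (simp add: Mon_def)

lemma Mon_transpose_mult: "M \<in> Mon n \<Longrightarrow> M\<^sup>T * M = 1\<^sub>m n"
  by (simp add: Mon_iff_orthogonal orthogonal_transpose)

lemma Mon_transpose: "M \<in> Mon n \<Longrightarrow> M\<^sup>T \<in> Mon n"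
  by (auto simp: Mon_iff_orthogonal orthogonal_transpose)

lemma Mon_mult:
  assumes "M \<in> Mon n" "N \<in> Mon n"
  shows "M * N \<in> Mon n"
proof -
  note c = Mon_carrier[OF assms(1)] Mon_carrier[OF assms(2)]
  have "(M * N) * (M * N)\<^sup>T = M * (N * N\<^sup>T) * M\<^sup>T"
    using c by (simp add: transpose_mult[of _ n n _ n] assoc_mult_mat[of _ n n _ n _ n])
  also have "\<dots> = 1\<^sub>m n" using assms c by (simp add: Mon_orthogonal)
  finally show ?thesis using c by (simp add: Mon_iff_orthogonal)
qed

section \<open>Connectedness of primitive matrices\<close>

text \<open>Brings the rows or columns of a union of components to the front, so that a splitting of
  the support becomes a splitting into diagonal blocks.\<close>

lemma ex_perm_initial_segment:
  assumes S: "S \<subseteq> {..<n :: nat}"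
  obtains f where "bij_betw f {..<n} {..<n}" "\<And>i. i < n \<Longrightarrow> f i \<in> S \<longleftrightarrow> i < card S"
proof -
  let ?m = "card S"
  have fin: "finite S" using S finite_subset by blast
  have m: "?m \<le> n" using card_mono[OF _ S] by simp
  obtain f where f: "bij_betw f {..<?m} S"
    using finite_same_card_bij[of "{..<?m}" S] fin by auto
  have "card {?m..<n} = card ({..<n} - S)"
    using S fin by (simp add: card_Diff_subset)
  then obtain g where g: "bij_betw g {?m..<n} ({..<n} - S)"
    using finite_same_card_bij[of "{?m..<n}" "{..<n} - S"] by auto
  define h where "h i = (if i < ?m then f i else g i)" for i
  have h1: "bij_betw h {..<?m} S"
    using f by (rule bij_betw_cong[THEN iffD1, rotated]) (simp add: h_def)
  have h2: "bij_betw h {?m..<n} ({..<n} - S)"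
    using g by (rule bij_betw_cong[THEN iffD1, rotated]) (simp add: h_def)
  have "bij_betw h ({..<?m} \<union> {?m..<n}) (S \<union> ({..<n} - S))"
    using h1 h2 by (rule bij_betw_combine) blast
  moreover have "{..<?m} \<union> {?m..<n} = {..<n}" "S \<union> ({..<n} - S) = {..<n}"
    using m S by auto
  ultimately have "bij_betw h {..<n} {..<n}" by simp
  moreover have "h i \<in> S \<longleftrightarrow> i < ?m" if "i < n" for i
  proof (cases "i < ?m")
    case True
    then show ?thesis using bij_betwE[OF h1] by auto
  next
    case False
    then show ?thesis using bij_betwE[OF h2] that by auto
  qed
  ultimately show ?thesis using that by blast
qed

lemma H_equiv_reindex:
  assumes C: "C \<in> carrier_mat n n"
    and f: "bij_betw f {..<n} {..<n}" and g: "bij_betw g {..<n} {..<n}"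
  shows "C \<sim>\<^sub>H mat n n (\<lambda>(i, j). C $$ (f i, g j))"
proof -
  \<comment> \<open>With the 1 of row \<open>i\<close> in column \<open>f i\<close>, left
    multiplication by \<open>P f\<close> puts row \<open>f i\<close> in place \<open>i\<close>;
    right multiplication by the transpose of \<open>P g\<close> does the same with columns.\<close>
  define P :: "(nat \<Rightarrow> nat) \<Rightarrow> int mat"
    where "P = (\<lambda>f. mat n n (\<lambda>(i, j). if j = f i then 1 else 0))"
  have P: "P f \<in> carrier_mat n n" for f by (simp add: P_def)
  have lt: "f i < n" "g i < n" if "i < n" for i
    using bij_betwE[OF f] bij_betwE[OF g] that by auto
  have Mon: "P f \<in> Mon n" if f: "bij_betw f {..<n} {..<n}" for f
  proof -
    have "P f * (P f)\<^sup>T = 1\<^sub>m n"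
    proof (rule eq_matI)
      fix i j assume "i < dim_row (1\<^sub>m n :: int mat)" "j < dim_col (1\<^sub>m n :: int mat)"
      then have ij: "i < n" "j < n" by auto
      then have fi: "f i < n" using bij_betwE[OF f] by auto
      have "(P f * (P f)\<^sup>T) $$ (i, j) = (\<Sum>c<n. P f $$ (i, c) * P f $$ (j, c))"
        by (rule mult_transpose_index[OF P P ij])
      also have "\<dots> = (\<Sum>c<n. if c = f i then (if f i = f j then 1 else 0) else 0)"
        using ij by (intro sum.cong) (auto simp: P_def)
      also have "\<dots> = (if f i = f j then 1 else 0)" using fi by simp
      also have "\<dots> = (if i = j then 1 else 0)"
        using f ij by (auto simp: bij_betw_def inj_on_def)
      finally show "(P f * (P f)\<^sup>T) $$ (i, j) = 1\<^sub>m n $$ (i, j)" using ij by simp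
    qed (simp_all add: P_def)
    then show ?thesis using P by (simp add: Mon_iff_orthogonal)
  qed
  have PC: "(P f * C) $$ (i, j) = C $$ (f i, j)" if "i < n" "j < n" for i j
  proof -
    have "(P f * C) $$ (i, j) = (\<Sum>c<n. P f $$ (i, c) * C\<^sup>T $$ (j, c))"
      using mult_transpose_index[OF P, of "C\<^sup>T" n i j f] that C by simp
    also have "\<dots> = (\<Sum>c<n. if c = f i then C $$ (f i, j) else 0)"
      using that C by (intro sum.cong) (auto simp: P_def)
    finally show ?thesis using lt that by simp
  qed
  have "mat n n (\<lambda>(i, j). C $$ (f i, g j)) = P f * C * (P g)\<^sup>T"
  proof (rule eq_matI)
    fix i j assume "i < dim_row (P f * C * (P g)\<^sup>T)" "j < dim_col (P f * C * (P g)\<^sup>T)"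
    then have ij: "i < n" "j < n" by (auto simp: P_def)
    have "(P f * C * (P g)\<^sup>T) $$ (i, j) = (\<Sum>c<n. (P f * C) $$ (i, c) * P g $$ (j, c))"
      by (rule mult_transpose_index[OF mult_carrier_mat[OF P C] P ij])
    also have "\<dots> = (\<Sum>c<n. if c = g j then C $$ (f i, g j) else 0)"
      using ij PC by (intro sum.cong) (auto simp: P_def)
    finally show "mat n n (\<lambda>(i, j). C $$ (f i, g j)) $$ (i, j) = (P f * C * (P g)\<^sup>T) $$ (i, j)"
      using lt ij by simp
  qed (simp_all add: P_def)
  then show ?thesis
    using Mon[OF f] Mon[OF g] C by (auto simp: H_equiv_def)
qed

text \<open>Double counting of squared entries. The rows in \<open>S\<close> contribute
  \<open>k\<close> each, and their entries outside \<open>T\<close> vanish; read by columns, the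
  same total is \<open>k\<close> for each element of \<open>T\<close>. Both the column norms and the
  final cancellation rest on \<open>k\<close> being nonzero.\<close>

lemma weighing_support_card_eq:
  fixes C :: "int mat"
  assumes C: "C \<in> carrier_mat n n" and k: "k \<noteq> 0" and eq: "C * C\<^sup>T = k \<cdot>\<^sub>m 1\<^sub>m n"
    and ST: "S \<subseteq> {..<n}" "T \<subseteq> {..<n}"
    and supp: "\<And>a b. a < n \<Longrightarrow> b < n \<Longrightarrow> C $$ (a, b) \<noteq> 0 \<Longrightarrow> a \<in> S \<longleftrightarrow> b \<in> T"
  shows "card S = card T"
proof -
  have row: "(\<Sum>b<n. C $$ (a, b) * C $$ (a, b)) = k" if "a < n" for a
    using mult_transpose_index[OF C C that that] that eq by simp
  have CT: "C\<^sup>T \<in> carrier_mat n n" using C by simp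
  have col: "(\<Sum>a<n. C $$ (a, b) * C $$ (a, b)) = k" if "b < n" for b
    using mult_transpose_index[OF CT CT that that] that C gram_transpose[OF C k eq] by simp
  have "int (card S) * k = (\<Sum>a\<in>S. \<Sum>b<n. C $$ (a, b) * C $$ (a, b))"
  proof -
    have "(\<Sum>a\<in>S. \<Sum>b<n. C $$ (a, b) * C $$ (a, b)) = (\<Sum>a\<in>S. k)"
      using row ST by (intro sum.cong) auto
    then show ?thesis by simp
  qed
  also have "\<dots> = (\<Sum>a\<in>S. \<Sum>b\<in>T. C $$ (a, b) * C $$ (a, b))"
  proof (rule sum.cong[OF refl], rule sum.mono_neutral_right)
    fix a assume "a \<in> S"
    then show "\<forall>b\<in>{..<n} - T. C $$ (a, b) * C $$ (a, b) = 0" using supp ST by force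
  qed (use ST in auto)
  also have "\<dots> = (\<Sum>b\<in>T. \<Sum>a\<in>S. C $$ (a, b) * C $$ (a, b))" by (rule sum.swap)
  also have "\<dots> = (\<Sum>b\<in>T. \<Sum>a<n. C $$ (a, b) * C $$ (a, b))"
  proof (rule sum.cong[OF refl], rule sum.mono_neutral_left)
    fix b assume "b \<in> T"
    then show "\<forall>a\<in>{..<n} - S. C $$ (a, b) * C $$ (a, b) = 0" using supp ST by force
  qed (use ST in auto)
  also have "\<dots> = int (card T) * k"
  proof -
    have "(\<Sum>b\<in>T. \<Sum>a<n. C $$ (a, b) * C $$ (a, b)) = (\<Sum>b\<in>T. k)"
      using col ST by (intro sum.cong) auto
    then show ?thesis by simp
  qed
  finally show ?thesis using k by simp
qed

text \<open>Primitivity says that the bipartite graph of nonzero entries is connected.\<close>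

lemma primitive_support_connected:
  assumes prim: "primitive_int_weighing_mat C" and C: "C \<in> carrier_mat n n"
    and ST: "S \<subseteq> {..<n}" "T \<subseteq> {..<n}"
    and supp: "\<And>a b. a < n \<Longrightarrow> b < n \<Longrightarrow> C $$ (a, b) \<noteq> 0 \<Longrightarrow> a \<in> S \<longleftrightarrow> b \<in> T"
  shows "S = {} \<and> T = {} \<or> S = {..<n} \<and> T = {..<n}"
proof -
  obtain k where k: "k \<noteq> 0" "C * C\<^sup>T = k \<cdot>\<^sub>m 1\<^sub>m n"
    using prim C by (auto simp: primitive_int_weighing_mat_def int_weighing_mat_def)
  define m where "m = card S"
  have mT: "m = card T" unfolding m_def by (rule weighing_support_card_eq[OF C k ST supp])
  have fin: "finite S" "finite T" using ST finite_subset by blast+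
  have mn: "m \<le> n" unfolding m_def using card_mono[OF _ ST(1)] by simp
  have "m = 0 \<or> m = n"
  proof (rule ccontr)
    \<comment> \<open>A proper part would cut \<open>C\<close>, after reordering, into diagonal
      blocks of orders \<open>m\<close> and \<open>n - m\<close>. They are square because
      \<open>S\<close> and \<open>T\<close> have the same size, and smaller than \<open>C\<close>,
      which is what primitivity forbids.\<close>
    assume "\<not> ?thesis"
    with mn have m: "0 < m" "m < n" by auto
    obtain f where f: "bij_betw f {..<n} {..<n}" "\<And>i. i < n \<Longrightarrow> f i \<in> S \<longleftrightarrow> i < m"
      using ex_perm_initial_segment[OF ST(1)] m_def by metis
    obtain g where g: "bij_betw g {..<n} {..<n}" "\<And>i. i < n \<Longrightarrow> g i \<in> T \<longleftrightarrow> i < m"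
      using ex_perm_initial_segment[OF ST(2)] mT by metis
    let ?M = "mat n n (\<lambda>(i, j). C $$ (f i, g j))"
    let ?M1 = "mat m m (\<lambda>(i, j). C $$ (f i, g j))"
    let ?M2 = "mat (n - m) (n - m) (\<lambda>(i, j). C $$ (f (i + m), g (j + m)))"
    have lt: "f i < n" "g i < n" if "i < n" for i
      using bij_betwE[OF f(1)] bij_betwE[OF g(1)] that by auto
    have zero: "C $$ (f i, g j) = 0" if "i < n" "j < n" "(i < m) \<noteq> (j < m)" for i j
      using supp[OF lt(1) lt(2), of i j] f(2) g(2) that by auto
    have "?M = diag_block_mat [?M1, ?M2]"
      using m by (intro eq_matI) (auto simp: Let_def zero)
    then have "C \<sim>\<^sub>H diag_block_mat [?M1, ?M2]"
      using H_equiv_reindex[OF C f(1) g(1)] by simp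
    moreover have "\<forall>B\<in>set [?M1, ?M2]. square_mat B \<and> dim_row B < dim_row C"
      using m C by auto
    moreover have "length [?M1, ?M2] \<ge> 2" by simp
    ultimately show False
      using prim unfolding primitive_int_weighing_mat_def by blast
  qed
  then show ?thesis
  proof
    assume "m = 0"
    then show ?thesis using m_def mT fin by auto
  next
    assume "m = n"
    then have "card S = card {..<n}" "card T = card {..<n}" using m_def mT by auto
    then show ?thesis using ST card_subset_eq[OF finite_lessThan] by blast
  qed
qed

text \<open>Locates every entry of a direct sum by block label and inner index. The labels are
  distinct although the blocks \<open>C k\<close> may coincide; this keeps the copies of one matrix
  distinguishable.\<close>

lemma diag_block_mat_reindex:
  assumes "distinct ks" and "\<And>k. k \<in> set ks \<Longrightarrow> C k \<in> carrier_mat (d k) (d k)"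
  shows "\<exists>e. bij_betw e (SIGMA k:set ks. {..<d k}) {..<sum_list (map d ks)} \<and>
    (\<forall>k\<in>set ks. \<forall>l\<in>set ks. \<forall>a<d k. \<forall>b<d l.
       diag_block_mat (map C ks) $$ (e (k, a), e (l, b)) = (if k = l then C k $$ (a, b) else 0))"
  using assms
proof (induction ks)
  case Nil
  then show ?case by (auto simp: bij_betw_def)
next
  case (Cons k0 ks)
  define n where "n = sum_list (map d ks)"
  let ?D = "diag_block_mat (map C ks)"
  obtain e where e: "bij_betw e (SIGMA k:set ks. {..<d k}) {..<n}"
    and D: "\<And>k l a b. k \<in> set ks \<Longrightarrow> l \<in> set ks \<Longrightarrow> a < d k \<Longrightarrow> b < d l \<Longrightarrow>
       ?D $$ (e (k, a), e (l, b)) = (if k = l then C k $$ (a, b) else 0)"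
    using Cons unfolding n_def by force
  have "map dim_row (map C ks) = map d ks" "map dim_col (map C ks) = map d ks"
    using Cons.prems(2) by auto
  then have dim: "dim_row ?D = n" "dim_col ?D = n"
    by (auto simp only: dim_diag_block_mat n_def)
  have k0: "k0 \<notin> set ks" and C0: "C k0 \<in> carrier_mat (d k0) (d k0)"
    using Cons.prems by auto
  have lt: "e (k, a) < n" if "k \<in> set ks" "a < d k" for k a
    using bij_betwE[OF e] that by auto
  \<comment> \<open>The new block takes the first \<open>d k0\<close> positions, and the positions
    of all other blocks move up by \<open>d k0\<close>.\<close>
  define e' where "e' = (\<lambda>(k, a). if k = k0 then a else d k0 + e (k, a))"
  have "bij_betw e' ({k0} \<times> {..<d k0}) {..<d k0}"
    by (rule bij_betw_byWitness[where f' = "Pair k0"]) (auto simp: e'_def)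
  moreover have "bij_betw e' (SIGMA k:set ks. {..<d k}) {d k0..<d k0 + n}"
  proof -
    have "bij_betw ((+) (d k0)) {..<n} {d k0..<d k0 + n}"
      by (auto simp: bij_betw_def image_add_atLeastLessThan lessThan_atLeast0)
    from bij_betw_trans[OF e this]
    show ?thesis
      by (rule bij_betw_cong[THEN iffD1, rotated]) (use k0 in \<open>auto simp: e'_def\<close>)
  qed
  ultimately have "bij_betw e' (({k0} \<times> {..<d k0}) \<union> (SIGMA k:set ks. {..<d k}))
      ({..<d k0} \<union> {d k0..<d k0 + n})"
    by (rule bij_betw_combine) auto
  moreover have "({k0} \<times> {..<d k0}) \<union> (SIGMA k:set ks. {..<d k}) = (SIGMA k:set (k0 # ks). {..<d k})"
    by auto
  moreover have "{..<d k0} \<union> {d k0..<d k0 + n} = {..<sum_list (map d (k0 # ks))}"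
    by (auto simp: n_def)
  ultimately have bij: "bij_betw e' (SIGMA k:set (k0 # ks). {..<d k}) {..<sum_list (map d (k0 # ks))}"
    by simp
  have "diag_block_mat (map C (k0 # ks)) $$ (e' (k, a), e' (l, b)) = (if k = l then C k $$ (a, b) else 0)"
    if kl: "k \<in> set (k0 # ks)" "l \<in> set (k0 # ks)" "a < d k" "b < d l" for k l a b
  proof -
    have less: "e' (k, a) < d k0 + n" if "k \<in> set (k0 # ks)" "a < d k" for k a
      using lt that by (auto simp: e'_def)
    have "diag_block_mat (map C (k0 # ks)) $$ (e' (k, a), e' (l, b)) =
      (let i = e' (k, a); j = e' (l, b) in
       if i < d k0 then if j < d k0 then C k0 $$ (i, j) else 0
       else if j < d k0 then 0 else ?D $$ (i - d k0, j - d k0))"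
      using less[OF kl(1,3)] less[OF kl(2,4)] C0 dim by (auto simp: Let_def)
    also have "\<dots> = (if k = l then C k $$ (a, b) else 0)"
      using kl k0 D by (auto simp: e'_def)
    finally show ?thesis .
  qed
  with bij show ?case by blast
qed

section \<open>Block permutation matrices\<close>

text \<open>The layout of the blocks is left open: \<open>e\<close> is any bijection between
  labelled positions and \<open>{..<n}\<close>. Nonempty blocks guarantee the position
  \<open>(k, 0)\<close>, which serves as representative of block \<open>k\<close>.\<close>

locale block_structure =
  fixes K :: "'k set" and d :: "'k \<Rightarrow> nat" and e :: "'k \<times> nat \<Rightarrow> nat" and n :: nat
  assumes finite_K: "finite K"
    and bij_e: "bij_betw e (SIGMA k:K. {..<d k}) {..<n}"
    and d_pos: "k \<in> K \<Longrightarrow> 0 < d k"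
begin

abbreviation idx :: "('k \<times> nat) set" where "idx \<equiv> SIGMA k:K. {..<d k}"

definition dec :: "nat \<Rightarrow> 'k \<times> nat" where "dec = inv_into idx e"

text \<open>\<open>blk \<tau> X\<close> has, in block column \<open>l\<close>, the single nonzero block \<open>X (\<tau> l)\<close> in block row \<open>\<tau> l\<close>.\<close>

definition blk :: "('k \<Rightarrow> 'k) \<Rightarrow> ('k \<Rightarrow> int mat) \<Rightarrow> int mat" where
  "blk \<tau> X = mat n n (\<lambda>(p, q).
     if fst (dec p) = \<tau> (fst (dec q)) then X (fst (dec p)) $$ (snd (dec p), snd (dec q)) else 0)"

lemma inv_size_preserving:
  assumes \<tau>: "\<tau> permutes K" and d: "\<And>k. k \<in> K \<Longrightarrow> d (\<tau> k) = d k" and k: "k \<in> K"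
  shows "inv' \<tau> k \<in> K" and "d (inv' \<tau> k) = d k"
proof -
  show "inv' \<tau> k \<in> K" using k permutes_in_image[OF permutes_inv[OF \<tau>]] by simp
  from d[OF this] show "d (inv' \<tau> k) = d k" using \<tau> by (simp add: permutes_inverses)
qed

lemma finite_idx: "finite idx"
  using finite_K by auto

lemma e_lt: "x \<in> idx \<Longrightarrow> e x < n"
  using bij_betwE[OF bij_e] by auto

lemma e_inject: "x \<in> idx \<Longrightarrow> y \<in> idx \<Longrightarrow> e x = e y \<longleftrightarrow> x = y"
  using bij_e by (auto simp: bij_betw_def inj_on_def)

lemma dec_e: "x \<in> idx \<Longrightarrow> dec (e x) = x"
  unfolding dec_def using bij_e by (simp add: bij_betw_def)

lemma dec_in: "p < n \<Longrightarrow> dec p \<in> idx"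
  and e_dec: "p < n \<Longrightarrow> e (dec p) = p"
  using bij_e inv_into_into[of p e idx] f_inv_into_f[of p e idx]
  by (auto simp: dec_def bij_betw_def)

lemma blk_carrier [simp]: "blk \<tau> X \<in> carrier_mat n n"
  by (simp add: blk_def)

lemma blk_index:
  assumes "(k, a) \<in> idx" "(l, b) \<in> idx"
  shows "blk \<tau> X $$ (e (k, a), e (l, b)) = (if k = \<tau> l then X k $$ (a, b) else 0)"
  using e_lt[OF assms(1)] e_lt[OF assms(2)] dec_e[OF assms(1)] dec_e[OF assms(2)]
  by (cases "k = \<tau> l") (auto simp: blk_def)

lemma mat_eqI:
  assumes "M \<in> carrier_mat n n" "N \<in> carrier_mat n n"
    and "\<And>k a l b. (k, a) \<in> idx \<Longrightarrow> (l, b) \<in> idx \<Longrightarrow>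
      M $$ (e (k, a), e (l, b)) = N $$ (e (k, a), e (l, b))"
  shows "M = N"
proof (rule eq_matI)
  fix i j assume "i < dim_row N" "j < dim_col N"
  then have ij: "i < n" "j < n" using assms(2) by auto
  obtain k a where ka: "dec i = (k, a)" by fastforce
  obtain l b where lb: "dec j = (l, b)" by fastforce
  show "M $$ (i, j) = N $$ (i, j)"
    using assms(3)[of k a l b] dec_in[OF ij(1)] dec_in[OF ij(2)] e_dec[OF ij(1)] e_dec[OF ij(2)] ka lb
    by simp
qed (use assms in auto)

lemma mult_index:
  assumes "M \<in> carrier_mat n n" "N \<in> carrier_mat n n" "x \<in> idx" "y \<in> idx"
  shows "(M * N) $$ (e x, e y) = (\<Sum>z\<in>idx. M $$ (e x, e z) * N $$ (e z, e y))"
proof -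
  have "(M * N) $$ (e x, e y) = (\<Sum>p<n. M $$ (e x, p) * N $$ (p, e y))"
    using assms e_lt[of x] e_lt[of y]
    by (auto simp: scalar_prod_def atLeast0LessThan intro!: sum.cong)
  also have "\<dots> = (\<Sum>z\<in>idx. M $$ (e x, e z) * N $$ (e z, e y))"
    using bij_e by (rule sum.reindex_bij_betw[symmetric])
  finally show ?thesis .
qed

lemma blk_cong:
  assumes "\<And>k. k \<in> K \<Longrightarrow> \<tau> k = \<tau>' k" "\<And>k. k \<in> K \<Longrightarrow> X k = X' k"
  shows "blk \<tau> X = blk \<tau>' X'"
  using assms by (intro mat_eqI) (auto simp: blk_index)

text \<open>Block row \<open>k\<close> of the left factor has its only block in block column
  \<open>inv' \<tau> k\<close>, where it meets the block of the right factor in block row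
  \<open>inv' \<tau> k\<close>. The resulting twist of the second family is the action of the
  permutations in a wreath product.\<close>

lemma blk_mult:
  assumes \<tau>: "\<tau> permutes K" and \<tau>': "\<tau>' permutes K"
    and d: "\<And>k. k \<in> K \<Longrightarrow> d (\<tau> k) = d k"
    and X: "\<And>k. k \<in> K \<Longrightarrow> X k \<in> carrier_mat (d k) (d k)"
    and X': "\<And>k. k \<in> K \<Longrightarrow> X' k \<in> carrier_mat (d k) (d k)"
    and d': "\<And>k. k \<in> K \<Longrightarrow> d (\<tau>' k) = d k"
  shows "blk \<tau> X * blk \<tau>' X' = blk (\<tau> \<circ> \<tau>') (\<lambda>k. X k * X' (inv' \<tau> k))"
proof (rule mat_eqI)
  fix k a l b assume ka: "(k, a) \<in> idx" and lb: "(l, b) \<in> idx"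
  let ?m = "\<tau>' l"
  have m: "?m \<in> K" using \<tau>' lb by (simp add: permutes_in_image)
  have "(blk \<tau> X * blk \<tau>' X') $$ (e (k, a), e (l, b)) =
    (\<Sum>z\<in>idx. blk \<tau> X $$ (e (k, a), e z) * blk \<tau>' X' $$ (e z, e (l, b)))"
    using ka lb by (intro mult_index) auto
  also have "\<dots> = (\<Sum>z\<in>{?m} \<times> {..<d ?m}. blk \<tau> X $$ (e (k, a), e z) * blk \<tau>' X' $$ (e z, e (l, b)))"
    using m lb finite_idx by (intro sum.mono_neutral_right) (auto simp: blk_index split: if_splits)
  also have "\<dots> = (\<Sum>c<d ?m. blk \<tau> X $$ (e (k, a), e (?m, c)) * blk \<tau>' X' $$ (e (?m, c), e (l, b)))"
    by (rule sum.reindex_bij_witness[where i = "Pair ?m" and j = snd]) auto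
  also have "\<dots> = (\<Sum>c<d ?m. if k = \<tau> ?m then X k $$ (a, c) * X' ?m $$ (c, b) else 0)"
    using m ka lb by (intro sum.cong) (auto simp: blk_index)
  also have "\<dots> = (if k = \<tau> ?m then (X k * X' (inv' \<tau> k)) $$ (a, b) else 0)"
  proof (cases "k = \<tau> ?m")
    case True
    have inv: "inv' \<tau> k = ?m" using True \<tau> by (simp add: permutes_inverses)
    have dk: "d k = d ?m" "d ?m = d l" using True d m d' lb by auto
    have k: "k \<in> K" using ka by simp
    have "(X k * X' ?m) $$ (a, b) = (\<Sum>c<d ?m. X k $$ (a, c) * X' ?m $$ (c, b))"
      using X[OF k] X'[OF m] dk ka lb
      by (auto simp: scalar_prod_def atLeast0LessThan intro!: sum.cong)
    then show ?thesis using True inv by simp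
  qed simp
  also have "\<dots> = blk (\<tau> \<circ> \<tau>') (\<lambda>k. X k * X' (inv' \<tau> k)) $$ (e (k, a), e (l, b))"
    using ka lb by (simp add: blk_index)
  finally show "(blk \<tau> X * blk \<tau>' X') $$ (e (k, a), e (l, b)) =
    blk (\<tau> \<circ> \<tau>') (\<lambda>k. X k * X' (inv' \<tau> k)) $$ (e (k, a), e (l, b))" .
qed (simp_all add: mult_carrier_mat[of _ n n])

text \<open>Blocks are labelled by their block row. The block in block column \<open>k\<close> lies
  in block row \<open>\<tau> k\<close>, so after transposition block row \<open>k\<close> carries
  the transpose of \<open>X (\<tau> k)\<close>.\<close>

lemma blk_transpose:
  assumes \<tau>: "\<tau> permutes K" and d: "\<And>k. k \<in> K \<Longrightarrow> d (\<tau> k) = d k"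
    and X: "\<And>k. k \<in> K \<Longrightarrow> X k \<in> carrier_mat (d k) (d k)"
  shows "(blk \<tau> X)\<^sup>T = blk (inv' \<tau>) (\<lambda>k. (X (\<tau> k))\<^sup>T)"
proof (rule mat_eqI)
  fix k a l b assume ka: "(k, a) \<in> idx" and lb: "(l, b) \<in> idx"
  have "(blk \<tau> X)\<^sup>T $$ (e (k, a), e (l, b)) = blk \<tau> X $$ (e (l, b), e (k, a))"
    using e_lt[OF ka] e_lt[OF lb] blk_carrier[of \<tau> X] by (metis carrier_matD index_transpose_mat(1))
  also have "\<dots> = (if l = \<tau> k then X l $$ (b, a) else 0)"
    using ka lb by (simp add: blk_index)
  also have "\<dots> = (if k = inv' \<tau> l then (X (\<tau> k))\<^sup>T $$ (a, b) else 0)"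
  proof (cases "l = \<tau> k")
    case True
    have "X (\<tau> k) \<in> carrier_mat (d k) (d k)" using X[of "\<tau> k"] d[of k] lb ka True by auto
    then show ?thesis using True ka lb d[of k] \<tau> by (auto simp: permutes_inverses)
  next
    case False
    then have "k \<noteq> inv' \<tau> l" using \<tau> by (auto simp: permutes_inverses)
    with False show ?thesis by simp
  qed
  also have "\<dots> = blk (inv' \<tau>) (\<lambda>k. (X (\<tau> k))\<^sup>T) $$ (e (k, a), e (l, b))"
    using ka lb by (simp add: blk_index)
  finally show "(blk \<tau> X)\<^sup>T $$ (e (k, a), e (l, b)) = \<dots>" .
qed simp_all

lemma one_mat_eq_blk: "1\<^sub>m n = blk id (\<lambda>k. 1\<^sub>m (d k))"
  by (rule mat_eqI) (auto simp: blk_index e_lt e_inject)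

lemma blk_id_inject:
  assumes eq: "blk id X = blk id Y" and k: "k \<in> K"
    and X: "X k \<in> carrier_mat (d k) (d k)" and Y: "Y k \<in> carrier_mat (d k) (d k)"
  shows "X k = Y k"
proof (rule eq_matI)
  fix a b assume "a < dim_row (Y k)" "b < dim_col (Y k)"
  then have "(k, a) \<in> idx" "(k, b) \<in> idx" using Y k by auto
  then show "X k $$ (a, b) = Y k $$ (a, b)"
    using blk_index[of k a k b id X] blk_index[of k a k b id Y] eq by simp
qed (use X Y in auto)

text \<open>The outer factors move blocks by the same \<open>\<tau>\<close>, so the product is block
  diagonal again: what stood at \<open>inv' \<tau> k\<close> is transformed by \<open>X k\<close>
  and \<open>Y k\<close> and lands at \<open>k\<close>. Invariance of a direct sum thus becomes one
  equation for each label.\<close>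

lemma blk_sandwich:
  assumes \<tau>: "\<tau> permutes K" and d: "\<And>k. k \<in> K \<Longrightarrow> d (\<tau> k) = d k"
    and X: "\<And>k. k \<in> K \<Longrightarrow> X k \<in> carrier_mat (d k) (d k)"
    and Y: "\<And>k. k \<in> K \<Longrightarrow> Y k \<in> carrier_mat (d k) (d k)"
    and C: "\<And>k. k \<in> K \<Longrightarrow> C k \<in> carrier_mat (d k) (d k)"
  shows "blk \<tau> X * blk id C * (blk \<tau> Y)\<^sup>T = blk id (\<lambda>k. X k * C (inv' \<tau> k) * (Y k)\<^sup>T)"
proof -
  have inv: "inv' \<tau> k \<in> K" "d (inv' \<tau> k) = d k" if "k \<in> K" for k
    using inv_size_preserving[OF \<tau> d that] by auto
  have \<tau>K: "\<tau> k \<in> K" if "k \<in> K" for k using that \<tau> by (simp add: permutes_in_image)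
  have XC: "X k * C (inv' \<tau> k) \<in> carrier_mat (d k) (d k)" if "k \<in> K" for k
    using X[OF that] C[OF inv(1)[OF that]] inv(2)[OF that] by simp
  have YT: "(Y (\<tau> k))\<^sup>T \<in> carrier_mat (d k) (d k)" if "k \<in> K" for k
    using Y[OF \<tau>K[OF that]] d[OF that] by simp
  have "blk \<tau> X * blk id C = blk \<tau> (\<lambda>k. X k * C (inv' \<tau> k))"
    using blk_mult[OF \<tau> permutes_id d X C] by simp
  moreover have "blk \<tau> (\<lambda>k. X k * C (inv' \<tau> k)) * blk (inv' \<tau>) (\<lambda>k. (Y (\<tau> k))\<^sup>T) =
     blk (\<tau> \<circ> inv' \<tau>) (\<lambda>k. X k * C (inv' \<tau> k) * (Y (\<tau> (inv' \<tau> k)))\<^sup>T)"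
    by (rule blk_mult[OF \<tau> permutes_inv[OF \<tau>] d XC YT inv(2)])
  ultimately show ?thesis
    using \<tau> by (simp add: blk_transpose[OF \<tau> d Y] permutes_inv_o permutes_inverses)
qed

text \<open>Sandwiching the identity shows that the Gram matrix of \<open>blk \<tau> X\<close> is
  block diagonal with the Gram matrices of the \<open>X k\<close>, so orthogonality is a condition
  on each block separately.\<close>

lemma blk_in_Mon_iff:
  assumes \<tau>: "\<tau> permutes K" and d: "\<And>k. k \<in> K \<Longrightarrow> d (\<tau> k) = d k"
    and X: "\<And>k. k \<in> K \<Longrightarrow> X k \<in> carrier_mat (d k) (d k)"
  shows "blk \<tau> X \<in> Mon n \<longleftrightarrow> (\<forall>k\<in>K. X k \<in> Mon (d k))"
proof -
  have inv: "inv' \<tau> k \<in> K" "d (inv' \<tau> k) = d k" if "k \<in> K" for k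
    using inv_size_preserving[OF \<tau> d that] by auto
  have "blk \<tau> X * (blk \<tau> X)\<^sup>T = blk \<tau> X * blk id (\<lambda>k. 1\<^sub>m (d k)) * (blk \<tau> X)\<^sup>T"
    by (simp add: right_mult_one_mat[OF blk_carrier] flip: one_mat_eq_blk)
  also have "\<dots> = blk id (\<lambda>k. X k * 1\<^sub>m (d (inv' \<tau> k)) * (X k)\<^sup>T)"
    by (rule blk_sandwich[OF \<tau> d X X]) auto
  also have "\<dots> = blk id (\<lambda>k. X k * (X k)\<^sup>T)"
    by (intro blk_cong) (simp_all add: right_mult_one_mat[OF X] inv(2))
  finally have eq: "blk \<tau> X * (blk \<tau> X)\<^sup>T = blk id (\<lambda>k. X k * (X k)\<^sup>T)" .
  have XX: "X k * (X k)\<^sup>T \<in> carrier_mat (d k) (d k)" if "k \<in> K" for k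
    using X[OF that] by simp
  have "blk id (\<lambda>k. X k * (X k)\<^sup>T) = 1\<^sub>m n \<longleftrightarrow> (\<forall>k\<in>K. X k * (X k)\<^sup>T = 1\<^sub>m (d k))"
  proof
    assume "blk id (\<lambda>k. X k * (X k)\<^sup>T) = 1\<^sub>m n"
    then have *: "blk id (\<lambda>k. X k * (X k)\<^sup>T) = blk id (\<lambda>k. 1\<^sub>m (d k))" by (simp add: one_mat_eq_blk)
    show "\<forall>k\<in>K. X k * (X k)\<^sup>T = 1\<^sub>m (d k)"
    proof
      fix k assume "k \<in> K"
      from blk_id_inject[OF * this] XX[OF this] show "X k * (X k)\<^sup>T = 1\<^sub>m (d k)" by simp
    qed
  next
    assume "\<forall>k\<in>K. X k * (X k)\<^sup>T = 1\<^sub>m (d k)"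
    then show "blk id (\<lambda>k. X k * (X k)\<^sup>T) = 1\<^sub>m n"
      unfolding one_mat_eq_blk by (intro blk_cong) auto
  qed
  then show ?thesis using X by (auto simp: Mon_iff_orthogonal eq)
qed

text \<open>A monomial block is nonzero, so the places of the blocks, and with them the permutation
  on \<open>K\<close>, are visible in the matrix.\<close>

lemma blk_inject:
  assumes eq: "blk \<tau> X = blk \<tau>' X'"
    and \<tau>: "\<tau> permutes K" and d: "\<And>k. k \<in> K \<Longrightarrow> d (\<tau> k) = d k"
    and X: "\<And>k. k \<in> K \<Longrightarrow> X k \<in> Mon (d k)" and X': "\<And>k. k \<in> K \<Longrightarrow> X' k \<in> Mon (d k)"
    and l: "l \<in> K"
  shows "\<tau> l = \<tau>' l" and "X l = X' l"
proof -
  have same: "\<tau> l = \<tau>' l" if l: "l \<in> K" for l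
  proof -
    have tl: "\<tau> l \<in> K" using \<tau> l by (simp add: permutes_in_image)
    obtain a where a: "a < d (\<tau> l)" "X (\<tau> l) $$ (a, 0) \<noteq> 0"
      using X[OF tl] d_pos[OF tl] by (auto simp: Mon_def)
    then have "(\<tau> l, a) \<in> idx" "(l, 0) \<in> idx" using tl l d_pos by auto
    from blk_index[OF this, of \<tau> X] blk_index[OF this, of \<tau>' X'] a eq show ?thesis
      by (auto split: if_splits)
  qed
  then show "\<tau> l = \<tau>' l" using l .
  \<comment> \<open>Block row \<open>l\<close> has its only block in block column
    \<open>inv' \<tau> l\<close>.\<close>
  define m where "m = inv' \<tau> l"
  have m: "m \<in> K" "\<tau> m = l" "d m = d l"
    using \<tau> inv_size_preserving[OF \<tau> d l]
    by (auto simp: m_def permutes_inverses)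
  show "X l = X' l"
  proof (rule eq_matI)
    fix a b assume "a < dim_row (X' l)" "b < dim_col (X' l)"
    then have "(l, a) \<in> idx" "(m, b) \<in> idx" using Mon_carrier[OF X'[OF l]] m l by auto
    from blk_index[OF this, of \<tau> X] blk_index[OF this, of \<tau>' X'] m same[OF m(1)] eq
    show "X l $$ (a, b) = X' l $$ (a, b)" by simp
  qed (use Mon_carrier[OF X[OF l]] Mon_carrier[OF X'[OF l]] in auto)
qed

end

section \<open>Automorphisms of a direct sum of primitive blocks\<close>

context block_structure
begin

text \<open>Forgets the signs, as the graph argument needs only the places of nonzero entries. The
  column condition defines \<open>\<pi>\<close>; the row condition makes it bijective.\<close>

lemma Mon_column_map:
  assumes "M \<in> Mon n"
  shows "\<exists>\<pi>. bij_betw \<pi> idx idx \<and> (\<forall>x\<in>idx. \<forall>y\<in>idx. M $$ (e y, e x) \<noteq> 0 \<longleftrightarrow> y = \<pi> x)"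
proof -
  have col: "\<exists>!y. y \<in> idx \<and> M $$ (e y, e x) \<noteq> 0" if "x \<in> idx" for x
  proof -
    have "\<exists>!i. i < n \<and> M $$ (i, e x) \<noteq> 0" using assms e_lt[OF that] by (simp add: Mon_def)
    then show ?thesis by (metis dec_e dec_in e_dec e_lt)
  qed
  have row: "\<exists>!x. x \<in> idx \<and> M $$ (e y, e x) \<noteq> 0" if "y \<in> idx" for y
  proof -
    have "\<exists>!j. j < n \<and> M $$ (e y, j) \<noteq> 0" using assms e_lt[OF that] by (simp add: Mon_def)
    then show ?thesis by (metis dec_e dec_in e_dec e_lt)
  qed
  define \<pi> where "\<pi> x = (THE y. y \<in> idx \<and> M $$ (e y, e x) \<noteq> 0)" for x
  have \<pi>: "\<pi> x \<in> idx" "M $$ (e (\<pi> x), e x) \<noteq> 0" if "x \<in> idx" for x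
    using theI'[OF col[OF that]] by (simp_all add: \<pi>_def)
  have iff: "M $$ (e y, e x) \<noteq> 0 \<longleftrightarrow> y = \<pi> x" if "x \<in> idx" "y \<in> idx" for x y
    using \<pi>[OF that(1)] col[OF that(1)] that by metis
  have "inj_on \<pi> idx"
    by (rule inj_onI) (metis \<pi> row)
  moreover have "\<pi> ` idx = idx"
  proof
    show "\<pi> ` idx \<subseteq> idx" using \<pi>(1) by blast
    show "idx \<subseteq> \<pi> ` idx"
    proof
      fix y assume y: "y \<in> idx"
      then obtain x where x: "x \<in> idx" "M $$ (e y, e x) \<noteq> 0" using row by blast
      then have "y = \<pi> x" using iff y by blast
      then show "y \<in> \<pi> ` idx" using x(1) by (rule image_eqI)
    qed
  qed
  ultimately have "bij_betw \<pi> idx idx" by (rule bij_betw_imageI)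
  then show ?thesis using iff by (intro exI[of _ \<pi>] conjI ballI)
qed

text \<open>Reduces block form to a statement about the support. The block in block row
  \<open>k\<close> is cut out of block column \<open>inv' \<tau> k\<close>, the only one where that
  block row can be nonzero.\<close>

lemma eq_blkI:
  assumes M: "M \<in> carrier_mat n n" and \<tau>: "\<tau> permutes K"
    and d: "\<And>k. k \<in> K \<Longrightarrow> d (\<tau> k) = d k"
    and supp: "\<And>k a l b. (k, a) \<in> idx \<Longrightarrow> (l, b) \<in> idx \<Longrightarrow>
      M $$ (e (k, a), e (l, b)) \<noteq> 0 \<Longrightarrow> k = \<tau> l"
  shows "M = blk \<tau> (\<lambda>k. mat (d k) (d k) (\<lambda>(a, b). M $$ (e (k, a), e (inv' \<tau> k, b))))"
proof (rule mat_eqI)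
  fix k a l b assume ka: "(k, a) \<in> idx" and lb: "(l, b) \<in> idx"
  show "M $$ (e (k, a), e (l, b)) =
    blk \<tau> (\<lambda>k. mat (d k) (d k) (\<lambda>(a, b). M $$ (e (k, a), e (inv' \<tau> k, b)))) $$ (e (k, a), e (l, b))"
  proof (cases "k = \<tau> l")
    case True
    then have "inv' \<tau> k = l" "d k = d l" using \<tau> d lb by (auto simp: permutes_inverses)
    then show ?thesis using ka lb True by (subst blk_index[OF ka lb]) auto
  next
    case False
    then show ?thesis using supp[OF ka lb] by (auto simp: blk_index[OF ka lb])
  qed
qed (simp_all add: M)

lemma automorphism_block_form:
  assumes prim: "\<And>k. k \<in> K \<Longrightarrow> primitive_int_weighing_mat (C k)"
    and C: "\<And>k. k \<in> K \<Longrightarrow> C k \<in> carrier_mat (d k) (d k)"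
    and L: "L \<in> Mon n" and R: "R \<in> Mon n" and eq: "L * blk id C * R\<^sup>T = blk id C"
  obtains \<tau> X Y where "\<tau> permutes K" "\<And>k. k \<in> K \<Longrightarrow> d (\<tau> k) = d k"
    "\<And>k. k \<in> K \<Longrightarrow> X k \<in> carrier_mat (d k) (d k)"
    "\<And>k. k \<in> K \<Longrightarrow> Y k \<in> carrier_mat (d k) (d k)"
    "L = blk \<tau> X" "R = blk \<tau> Y"
proof -
  let ?D = "blk id C"
  note Lc = Mon_carrier[OF L] and Rc = Mon_carrier[OF R]
  have "?D * R = L * ?D * R\<^sup>T * R" by (simp add: eq)
  also have "\<dots> = L * ?D * (R\<^sup>T * R)"
    using Lc Rc by (intro assoc_mult_mat[of _ n n _ n _ n]) auto
  also have "\<dots> = L * ?D"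
    using Lc by (simp add: Mon_transpose_mult[OF R] right_mult_one_mat[of _ n n])
  finally have comm: "?D * R = L * ?D" .
  from Mon_column_map[OF L] obtain \<pi> where \<pi>_ex: "bij_betw \<pi> idx idx \<and>
      (\<forall>x\<in>idx. \<forall>y\<in>idx. L $$ (e y, e x) \<noteq> 0 \<longleftrightarrow> y = \<pi> x)" ..
  note \<pi> = conjunct1[OF \<pi>_ex] bspec[OF bspec[OF conjunct2[OF \<pi>_ex]]]
  from Mon_column_map[OF R] obtain \<rho> where \<rho>_ex: "bij_betw \<rho> idx idx \<and>
      (\<forall>x\<in>idx. \<forall>y\<in>idx. R $$ (e y, e x) \<noteq> 0 \<longleftrightarrow> y = \<rho> x)" ..
  note \<rho> = conjunct1[OF \<rho>_ex] bspec[OF bspec[OF conjunct2[OF \<rho>_ex]]]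
  have \<pi>in: "\<pi> x \<in> idx" and \<rho>in: "\<rho> x \<in> idx" if "x \<in> idx" for x
    using bij_betwE[OF \<pi>(1)] bij_betwE[OF \<rho>(1)] that by auto
  \<comment> \<open>In row \<open>\<pi> x\<close> and column \<open>y\<close>, only the summand
    \<open>z = \<rho> y\<close> survives in \<open>?D * R\<close> and only \<open>z = x\<close> in
    \<open>L * ?D\<close>. As the monomial entries are nonzero, \<open>\<pi>\<close> on rows and
    \<open>\<rho>\<close> on columns send nonzero entries of \<open>?D\<close> to nonzero
    entries.\<close>
  have entry: "?D $$ (e (\<pi> x), e (\<rho> y)) * R $$ (e (\<rho> y), e y) =
      L $$ (e (\<pi> x), e x) * ?D $$ (e x, e y)" if x: "x \<in> idx" and y: "y \<in> idx" for x y
  proof -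
    have "?D $$ (e (\<pi> x), e (\<rho> y)) * R $$ (e (\<rho> y), e y) =
      (\<Sum>z\<in>{\<rho> y}. ?D $$ (e (\<pi> x), e z) * R $$ (e z, e y))" by simp
    also have "\<dots> = (\<Sum>z\<in>idx. ?D $$ (e (\<pi> x), e z) * R $$ (e z, e y))"
      using \<rho>in[OF y] \<rho>(2)[OF y] finite_idx by (intro sum.mono_neutral_left) auto
    also have "\<dots> = (?D * R) $$ (e (\<pi> x), e y)"
      using Rc \<pi>in[OF x] y by (intro mult_index[symmetric]) auto
    also have "\<dots> = (L * ?D) $$ (e (\<pi> x), e y)" by (simp add: comm)
    also have "\<dots> = (\<Sum>z\<in>idx. L $$ (e (\<pi> x), e z) * ?D $$ (e z, e y))"
      using Lc \<pi>in[OF x] y by (intro mult_index) auto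
    also have "\<dots> = (\<Sum>z\<in>{x}. L $$ (e (\<pi> x), e z) * ?D $$ (e z, e y))"
    proof (rule sum.mono_neutral_right)
      show "\<forall>z\<in>idx - {x}. L $$ (e (\<pi> x), e z) * ?D $$ (e z, e y) = 0"
      proof
        fix z assume z: "z \<in> idx - {x}"
        then have "\<pi> x \<noteq> \<pi> z" using \<pi>(1) x by (auto simp: bij_betw_def dest: inj_onD)
        then show "L $$ (e (\<pi> x), e z) * ?D $$ (e z, e y) = 0"
          using \<pi>(2)[of z "\<pi> x"] \<pi>in[OF x] z by (metis DiffD1 mult_zero_left)
      qed
    qed (use x finite_idx in auto)
    finally show ?thesis by simp
  qed
  have same_block: "fst (\<pi> (k, a)) = fst (\<rho> (k, b))"
    if "k \<in> K" "a < d k" "b < d k" "C k $$ (a, b) \<noteq> 0" for k a b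
  proof -
    have x: "(k, a) \<in> idx" and y: "(k, b) \<in> idx" using that by auto
    have "?D $$ (e (k, a), e (k, b)) \<noteq> 0" using blk_index[OF x y] that(4) by simp
    then have "?D $$ (e (\<pi> (k, a)), e (\<rho> (k, b))) \<noteq> 0"
      using entry[OF x y] \<pi>(2)[OF x \<pi>in[OF x]] by auto
    then show ?thesis
      using blk_index[of "fst (\<pi> (k, a))" "snd (\<pi> (k, a))" "fst (\<rho> (k, b))" "snd (\<rho> (k, b))" id C]
        \<pi>in[OF x] \<rho>in[OF y] by (metis id_apply prod.collapse)
  qed
  \<comment> \<open>Row \<open>0\<close> of block \<open>k\<close> is the reference; its image will
    decide the target of all rows and columns of the block.\<close>
  define t where "t k = fst (\<pi> (k, 0))" for k
  have t: "fst (\<pi> (k, a)) = t k \<and> fst (\<rho> (k, a)) = t k" if k: "k \<in> K" and a: "a < d k" for k a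
  proof -
    \<comment> \<open>A nonzero entry of \<open>C k\<close> has its row and its column sent to the
      same block, so \<open>?S\<close> and \<open>?T\<close> together form a union of components. As
      \<open>?S\<close> contains \<open>0\<close>, both are everything.\<close>
    let ?S = "{a. a < d k \<and> fst (\<pi> (k, a)) = t k}" and ?T = "{b. b < d k \<and> fst (\<rho> (k, b)) = t k}"
    have "?S = {} \<and> ?T = {} \<or> ?S = {..<d k} \<and> ?T = {..<d k}"
      using same_block[OF k]
      by (intro primitive_support_connected[OF prim[OF k] C[OF k]]) auto
    moreover have "0 \<in> ?S" using d_pos[OF k] by (simp add: t_def)
    ultimately have "a \<in> ?S" "a \<in> ?T" using a by blast+
    then show ?thesis by blast
  qed
  have tK: "t k \<in> K" if "k \<in> K" for k
    using \<pi>in[of "(k, 0)"] d_pos[OF that] that unfolding t_def by (metis SigmaI SigmaE fst_conv lessThan_iff)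
  have hit: "\<exists>k\<in>K. \<exists>b<d k. \<pi> (k, b) = (k', a') \<and> t k = k'" if "k' \<in> K" "a' < d k'" for k' a'
  proof -
    have "(k', a') \<in> \<pi> ` idx" using \<pi>(1) that by (auto simp: bij_betw_def)
    then obtain k b where "k \<in> K" "b < d k" "\<pi> (k, b) = (k', a')" by auto
    with t[of k b] show ?thesis by auto
  qed
  have timg: "t ` K = K" using tK hit d_pos by force
  have tinj: "inj_on t K" by (rule eq_card_imp_inj_on[OF finite_K]) (simp add: timg)
  \<comment> \<open>Every position of block \<open>t k\<close> is hit by \<open>\<pi>\<close> from a
    block with the same image under \<open>t\<close>, which can only be block \<open>k\<close>.
    Hence \<open>\<pi>\<close> maps block \<open>k\<close> onto block \<open>t k\<close>, and the
    sizes agree.\<close>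
  have dt: "d (t k) = d k" if k: "k \<in> K" for k
  proof -
    have "(\<lambda>a. \<pi> (k, a)) ` {..<d k} = {t k} \<times> {..<d (t k)}"
    proof
      show "(\<lambda>a. \<pi> (k, a)) ` {..<d k} \<subseteq> {t k} \<times> {..<d (t k)}"
      proof
        fix y assume "y \<in> (\<lambda>a. \<pi> (k, a)) ` {..<d k}"
        then obtain a where a: "a < d k" "y = \<pi> (k, a)" by blast
        with \<pi>in[of "(k, a)"] t[OF k a(1)] k show "y \<in> {t k} \<times> {..<d (t k)}"
          by (cases y) auto
      qed
      show "{t k} \<times> {..<d (t k)} \<subseteq> (\<lambda>a. \<pi> (k, a)) ` {..<d k}"
      proof
        fix y assume "y \<in> {t k} \<times> {..<d (t k)}"
        then obtain a' where a': "y = (t k, a')" "a' < d (t k)" by auto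
        from hit[OF tK[OF k] a'(2)] obtain k2 b where
          k2: "k2 \<in> K" "b < d k2" "\<pi> (k2, b) = (t k, a')" "t k2 = t k" by blast
        then have "k2 = k" using tinj k by (simp add: inj_on_def)
        with k2 a' show "y \<in> (\<lambda>a. \<pi> (k, a)) ` {..<d k}"
          by (metis imageI lessThan_iff)
      qed
    qed
    moreover have "inj_on (\<lambda>a. \<pi> (k, a)) {..<d k}"
    proof (rule inj_onI)
      fix a b assume "a \<in> {..<d k}" "b \<in> {..<d k}" "\<pi> (k, a) = \<pi> (k, b)"
      then show "a = b"
        using \<pi>(1) k by (auto simp: bij_betw_def dest: inj_onD[of \<pi> idx "(k, a)" "(k, b)"])
    qed
    ultimately have "card ({t k} \<times> {..<d (t k)}) = card {..<d k}" using card_image by metis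
    then show ?thesis by (simp add: card_cartesian_product)
  qed
  \<comment> \<open>\<open>permutes\<close> requires the identity outside \<open>K\<close>, where
    \<open>t\<close> has no meaning.\<close>
  define \<tau> where "\<tau> k = (if k \<in> K then t k else k)" for k
  have "bij_betw t K K" using tinj timg by (simp add: bij_betw_def)
  then have "bij_betw \<tau> K K"
    by (rule bij_betw_cong[THEN iffD1, rotated]) (simp add: \<tau>_def)
  then have \<tau>: "\<tau> permutes K" by (rule bij_imp_permutes) (simp add: \<tau>_def)
  have d\<tau>: "d (\<tau> k) = d k" if "k \<in> K" for k using dt that by (simp add: \<tau>_def)
  have "k = \<tau> l" if x: "(k, a) \<in> idx" and y: "(l, b) \<in> idx" and nz: "L $$ (e (k, a), e (l, b)) \<noteq> 0" for k a l b
    using \<pi>(2)[OF y x] nz t[of l b] y by (metis SigmaE2 \<tau>_def fst_conv lessThan_iff)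
  note Lblk = eq_blkI[OF Lc \<tau> d\<tau> this]
  have "k = \<tau> l" if x: "(k, a) \<in> idx" and y: "(l, b) \<in> idx" and nz: "R $$ (e (k, a), e (l, b)) \<noteq> 0" for k a l b
    using \<rho>(2)[OF y x] nz t[of l b] y by (metis SigmaE2 \<tau>_def fst_conv lessThan_iff)
  note Rblk = eq_blkI[OF Rc \<tau> d\<tau> this]
  show ?thesis by (rule that[OF \<tau> d\<tau> _ _ Lblk Rblk]) simp_all
qed

end

section \<open>Automorphism groups and wreath products\<close>

lemma int_weighing_mat_carrier:
  "int_weighing_mat A \<Longrightarrow> A \<in> carrier_mat (dim_row A) (dim_row A) \<and> 0 < dim_row A"
  by (auto simp: int_weighing_mat_def)

lemma carrier_Aut_mat:
  assumes "A \<in> carrier_mat n n"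
  shows "(L, R) \<in> carrier (Aut_mat A) \<longleftrightarrow> L \<in> Mon n \<and> R \<in> Mon n \<and> L * A * R\<^sup>T = A"
  using assms by (simp add: Aut_mat_def)

lemma mult_Aut_mat: "x \<otimes>\<^bsub>Aut_mat A\<^esub> y = (fst x * fst y, snd x * snd y)"
  by (simp add: Aut_mat_def split: prod.splits)

lemma Aut_mat_mult_closed:
  assumes A: "A \<in> carrier_mat n n" and x: "x \<in> carrier (Aut_mat A)" and y: "y \<in> carrier (Aut_mat A)"
  shows "x \<otimes>\<^bsub>Aut_mat A\<^esub> y \<in> carrier (Aut_mat A)"
proof -
  obtain L R where LR: "x = (L, R)" "L \<in> Mon n" "R \<in> Mon n" "L * A * R\<^sup>T = A"
    using x carrier_Aut_mat[OF A] by (cases x) auto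
  obtain L' R' where LR': "y = (L', R')" "L' \<in> Mon n" "R' \<in> Mon n" "L' * A * R'\<^sup>T = A"
    using y carrier_Aut_mat[OF A] by (cases y) auto
  note c = LR(2,3)[THEN Mon_carrier] LR'(2,3)[THEN Mon_carrier]
  have "(L * L') * A * (R * R')\<^sup>T = L * (L' * A * R'\<^sup>T) * R\<^sup>T"
    using c A by (simp add: transpose_mult[of _ n n _ n] assoc_mult_mat[of _ n n _ n _ n])
  then show ?thesis
    using LR LR' by (simp add: mult_Aut_mat carrier_Aut_mat[OF A] Mon_mult)
qed

text \<open>Transports automorphisms along an H-equivalence: the inner factors
  \<open>P\<^sup>T * P\<close> and \<open>Q\<^sup>T * Q\<close> cancel.\<close>

lemma Aut_mat_conj:
  assumes A: "A \<in> carrier_mat n n" and P: "P \<in> Mon n" and Q: "Q \<in> Mon n"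
    and LR: "(L, R) \<in> carrier (Aut_mat A)"
  shows "(P * L * P\<^sup>T, Q * R * Q\<^sup>T) \<in> carrier (Aut_mat (P * A * Q\<^sup>T))"
proof -
  have L: "L \<in> Mon n" and R: "R \<in> Mon n" and eq: "L * A * R\<^sup>T = A"
    using LR carrier_Aut_mat[OF A] by auto
  note c = L[THEN Mon_carrier] R[THEN Mon_carrier] P[THEN Mon_carrier] Q[THEN Mon_carrier]
  have D: "P * A * Q\<^sup>T \<in> carrier_mat n n" using c A by auto
  have "P * L * P\<^sup>T * (P * A * Q\<^sup>T) * (Q * R * Q\<^sup>T)\<^sup>T =
      P * L * (P\<^sup>T * P) * A * (Q\<^sup>T * Q) * R\<^sup>T * Q\<^sup>T"
    using c A by (simp add: transpose_mult[of _ n n _ n] assoc_mult_mat[of _ n n _ n _ n])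
  also have "\<dots> = P * (L * A * R\<^sup>T) * Q\<^sup>T"
    using c A by (simp add: Mon_transpose_mult[OF P] Mon_transpose_mult[OF Q]
        assoc_mult_mat[of _ n n _ n _ n])
  finally show ?thesis
    by (simp add: carrier_Aut_mat[OF D] eq Mon_mult Mon_transpose P Q L R)
qed

lemma Mon_conj_cancel:
  assumes M: "M \<in> carrier_mat n n" and P: "P \<in> Mon n"
  shows "P\<^sup>T * (P * M * P\<^sup>T) * P\<^sup>T\<^sup>T = M" and "P * (P\<^sup>T * M * P\<^sup>T\<^sup>T) * P\<^sup>T = M"
proof -
  note c = M Mon_carrier[OF P]
  have "P\<^sup>T * (P * M * P\<^sup>T) * P\<^sup>T\<^sup>T = (P\<^sup>T * P) * M * (P\<^sup>T * P)"
    using c by (simp add: assoc_mult_mat[of _ n n _ n _ n])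
  then show "P\<^sup>T * (P * M * P\<^sup>T) * P\<^sup>T\<^sup>T = M" using c by (simp add: Mon_transpose_mult[OF P])
  have "P * (P\<^sup>T * M * P\<^sup>T\<^sup>T) * P\<^sup>T = (P * P\<^sup>T) * M * (P * P\<^sup>T)"
    using c by (simp add: assoc_mult_mat[of _ n n _ n _ n])
  then show "P * (P\<^sup>T * M * P\<^sup>T\<^sup>T) * P\<^sup>T = M" using c by (simp add: Mon_orthogonal[OF P])
qed

text \<open>Conjugation by \<open>P\<close> and \<open>Q\<close> is undone by conjugation with their
  transposes, which carry \<open>D\<close> back to \<open>A\<close>. Being an \<open>iso\<close>
  means being a multiplicative bijection of carriers.\<close>

lemma Aut_mat_H_equiv:
  assumes A: "A \<in> carrier_mat n n" and "A \<sim>\<^sub>H D"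
  shows "Aut_mat A \<cong> Aut_mat D"
proof -
  obtain P Q where P: "P \<in> Mon n" and Q: "Q \<in> Mon n" and D: "D = P * A * Q\<^sup>T"
    using assms by (auto simp: H_equiv_def)
  note c = A P[THEN Mon_carrier] Q[THEN Mon_carrier]
  have Dc: "D \<in> carrier_mat n n" using c by (auto simp: D)
  have "P\<^sup>T * D * Q\<^sup>T\<^sup>T = (P\<^sup>T * P) * A * (Q\<^sup>T * Q)"
    using c by (simp add: D assoc_mult_mat[of _ n n _ n _ n])
  then have A': "P\<^sup>T * D * Q\<^sup>T\<^sup>T = A"
    using c by (simp add: Mon_transpose_mult[OF P] Mon_transpose_mult[OF Q])
  define f where "f = (\<lambda>(L, R). (P * L * P\<^sup>T, Q * R * Q\<^sup>T))"
  define g where "g = (\<lambda>(L, R). (P\<^sup>T * L * P\<^sup>T\<^sup>T, Q\<^sup>T * R * Q\<^sup>T\<^sup>T))"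
  have f: "f x \<in> carrier (Aut_mat D)" if "x \<in> carrier (Aut_mat A)" for x
    using Aut_mat_conj[OF A P Q] that by (auto simp: f_def D split: prod.splits)
  have g: "g x \<in> carrier (Aut_mat A)" if "x \<in> carrier (Aut_mat D)" for x
    using Aut_mat_conj[OF Dc Mon_transpose[OF P] Mon_transpose[OF Q]] that
    unfolding A' by (auto simp: g_def split: prod.splits)
  have comps: "fst x \<in> carrier_mat n n" "snd x \<in> carrier_mat n n"
    if "x \<in> carrier (Aut_mat A) \<or> x \<in> carrier (Aut_mat D)" for x
    using that carrier_Aut_mat[OF A] carrier_Aut_mat[OF Dc] Mon_carrier by (cases x; auto)+
  have "bij_betw f (carrier (Aut_mat A)) (carrier (Aut_mat D))"
  proof (rule bij_betw_byWitness[where f' = g])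
    show "\<forall>x\<in>carrier (Aut_mat A). g (f x) = x"
    proof
      fix x assume x: "x \<in> carrier (Aut_mat A)"
      show "g (f x) = x"
        using Mon_conj_cancel(1)[OF comps(1) P, of x] Mon_conj_cancel(1)[OF comps(2) Q, of x] x
        by (cases x) (simp add: f_def g_def)
    qed
    show "\<forall>x\<in>carrier (Aut_mat D). f (g x) = x"
    proof
      fix x assume x: "x \<in> carrier (Aut_mat D)"
      show "f (g x) = x"
        using Mon_conj_cancel(2)[OF comps(1) P, of x] Mon_conj_cancel(2)[OF comps(2) Q, of x] x
        by (cases x) (simp add: f_def g_def)
    qed
  qed (use f g in auto)
  moreover have "f (x \<otimes>\<^bsub>Aut_mat A\<^esub> y) = f x \<otimes>\<^bsub>Aut_mat D\<^esub> f y"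
    if x: "x \<in> carrier (Aut_mat A)" and y: "y \<in> carrier (Aut_mat A)" for x y
  proof -
    have *: "S * (M * N) * S\<^sup>T = (S * M * S\<^sup>T) * (S * N * S\<^sup>T)"
      if S: "S \<in> Mon n" and M: "M \<in> carrier_mat n n" and N: "N \<in> carrier_mat n n" for S M N
    proof -
      note c = S[THEN Mon_carrier] M N
      have "(S * M * S\<^sup>T) * (S * N * S\<^sup>T) = S * M * (S\<^sup>T * S) * N * S\<^sup>T"
        using c by (simp add: assoc_mult_mat[of _ n n _ n _ n])
      also have "\<dots> = S * (M * N) * S\<^sup>T"
        using c by (simp add: Mon_transpose_mult[OF S] assoc_mult_mat[of _ n n _ n _ n])
      finally show ?thesis ..
    qed
    show ?thesis
      using *[OF P comps(1) comps(1), of x y] *[OF Q comps(2) comps(2), of x y] x y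
      by (cases x; cases y) (simp add: mult_Aut_mat f_def)
  qed
  ultimately have "f \<in> iso (Aut_mat A) (Aut_mat D)"
    using f by (auto simp: iso_def hom_def)
  then show ?thesis by (auto simp: is_iso_def)
qed

text \<open>Closure in \<open>G\<close> ensures that the product of two preimages lies in the
  carrier, where \<open>inv_into\<close> recovers it. This makes the inverse multiplicative without
  a detour through the group axioms.\<close>

lemma iso_inv_of_mult_closed:
  assumes h: "h \<in> iso G H"
    and closed: "\<And>x y. x \<in> carrier G \<Longrightarrow> y \<in> carrier G \<Longrightarrow> x \<otimes>\<^bsub>G\<^esub> y \<in> carrier G"
  shows "H \<cong> G"
proof -
  let ?g = "inv_into (carrier G) h"
  have bij: "bij_betw h (carrier G) (carrier H)"
    and hom: "\<And>x y. x \<in> carrier G \<Longrightarrow> y \<in> carrier G \<Longrightarrow> h (x \<otimes>\<^bsub>G\<^esub> y) = h x \<otimes>\<^bsub>H\<^esub> h y"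
    using h by (auto simp: iso_def hom_def)
  have g: "?g x \<in> carrier G" "h (?g x) = x" if "x \<in> carrier H" for x
    using that bij bij_betw_inv_into_right[OF bij] bij_betwE[OF bij_betw_inv_into[OF bij]] by auto
  have "?g (x \<otimes>\<^bsub>H\<^esub> y) = ?g x \<otimes>\<^bsub>G\<^esub> ?g y" if x: "x \<in> carrier H" and y: "y \<in> carrier H" for x y
  proof -
    have "x \<otimes>\<^bsub>H\<^esub> y = h (?g x \<otimes>\<^bsub>G\<^esub> ?g y)" using hom g x y by simp
    then show ?thesis
      using bij_betw_inv_into_left[OF bij closed[OF g(1)[OF x] g(1)[OF y]]] by simp
  qed
  then have "?g \<in> iso H G"
    using g(1) bij_betw_inv_into[OF bij] by (auto simp: iso_def hom_def)
  then show ?thesis by (auto simp: is_iso_def)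
qed

section \<open>Carrier, product and order of a wreath product\<close>

lemma carrier_wreath_sym:
  "carrier (wreath_sym G r) = ({1..r} \<rightarrow>\<^sub>E carrier G) \<times> {\<sigma>. \<sigma> permutes {1..r}}"
  by (simp add: wreath_sym_def semidirect_product_def sym_group_def)

lemma mult_wreath_sym:
  "x \<otimes>\<^bsub>wreath_sym G r\<^esub> y =
    (\<lambda>i\<in>{1..r}. fst x i \<otimes>\<^bsub>G\<^esub> (\<lambda>j\<in>{1..r}. fst y (inv' (snd x) j)) i, snd x \<circ> snd y)"
  by (cases x; cases y) (simp add: wreath_sym_def semidirect_product_def sym_group_def)

lemma wreath_sym_mult_closed:
  assumes closed: "\<And>x y. x \<in> carrier G \<Longrightarrow> y \<in> carrier G \<Longrightarrow> x \<otimes>\<^bsub>G\<^esub> y \<in> carrier G"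
    and x: "x \<in> carrier (wreath_sym G r)" and y: "y \<in> carrier (wreath_sym G r)"
  shows "x \<otimes>\<^bsub>wreath_sym G r\<^esub> y \<in> carrier (wreath_sym G r)"
proof -
  have \<sigma>: "snd x permutes {1..r}" "snd y permutes {1..r}"
    using x y by (auto simp: carrier_wreath_sym)
  have h: "fst x i \<in> carrier G" "fst y i \<in> carrier G" if "i \<in> {1..r}" for i
    using x y that by (auto simp: carrier_wreath_sym)
  have "inv' (snd x) i \<in> {1..r}" if "i \<in> {1..r}" for i
    using that by (simp only: permutes_in_image[OF permutes_inv[OF \<sigma>(1)]])
  then show ?thesis
    using h closed permutes_compose[OF \<sigma>(2,1)]
    by (auto simp: carrier_wreath_sym mult_wreath_sym)
qed

lemma order_wreath_sym: "order (wreath_sym G r) = order G ^ r * fact r"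
  by (simp add: order_def carrier_wreath_sym card_cartesian_product card_PiE card_permutations)

section \<open>Sums of primitive blocks\<close>

lemma distinct_concat_Pair:
  assumes "distinct ts" and "\<And>t. distinct (f t)"
  shows "distinct (concat (map (\<lambda>t. map (Pair t) (f t)) ts))"
  using assms by (induction ts) (auto simp: distinct_map inj_on_def)

text \<open>The label \<open>(t, i)\<close> stands for the \<open>i\<close>-th copy of
  \<open>B t\<close>; size and block depend on \<open>t\<close> alone. Inequivalence enters in
  surjectivity, where it prevents a copy of one \<open>B t\<close> from taking the place of a copy
  of another.\<close>

locale primitive_block_sum =
  block_structure "SIGMA t:{1..s}. {1..r t}" "\<lambda>(t, i). dim_row (B t)" e n
  for B :: "nat \<Rightarrow> int mat" and r :: "nat \<Rightarrow> nat" and s :: nat and e n +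
  assumes primitive: "t \<in> {1..s} \<Longrightarrow> primitive_int_weighing_mat (B t)"
    and inequivalent: "t \<in> {1..s} \<Longrightarrow> t' \<in> {1..s} \<Longrightarrow> t \<noteq> t' \<Longrightarrow> \<not> B t \<sim>\<^sub>H B t'"
begin

abbreviation K :: "(nat \<times> nat) set" where "K \<equiv> SIGMA t:{1..s}. {1..r t}"

abbreviation d :: "nat \<times> nat \<Rightarrow> nat" where "d \<equiv> \<lambda>(t, i). dim_row (B t)"

abbreviation C :: "nat \<times> nat \<Rightarrow> int mat" where "C \<equiv> \<lambda>(t, i). B t"

abbreviation W :: "(nat \<Rightarrow> (nat \<Rightarrow> int mat \<times> int mat) \<times> (nat \<Rightarrow> nat)) monoid" where
  "W \<equiv> product_group {1..s} (\<lambda>t. wreath_sym (Aut_mat (B t)) (r t))"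

text \<open>For \<open>w\<close> in the carrier of \<open>W\<close>, values outside
  \<open>{1..s}\<close> are \<open>undefined\<close>, so the identity is put in by hand there to
  obtain a permutation in the sense of \<open>permutes\<close>.\<close>

definition perm :: "(nat \<Rightarrow> 'x \<times> (nat \<Rightarrow> nat)) \<Rightarrow> nat \<times> nat \<Rightarrow> nat \<times> nat" where
  "perm w = (\<lambda>(t, i). if t \<in> {1..s} then (t, snd (w t) i) else (t, i))"

definition lmat :: "(nat \<Rightarrow> (nat \<Rightarrow> int mat \<times> int mat) \<times> (nat \<Rightarrow> nat)) \<Rightarrow> nat \<times> nat \<Rightarrow> int mat" where
  "lmat w = (\<lambda>(t, i). fst (fst (w t) i))"

definition rmat :: "(nat \<Rightarrow> (nat \<Rightarrow> int mat \<times> int mat) \<times> (nat \<Rightarrow> nat)) \<Rightarrow> nat \<times> nat \<Rightarrow> int mat" where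
  "rmat w = (\<lambda>(t, i). snd (fst (w t) i))"

text \<open>Component \<open>i\<close> of the \<open>t\<close>-th factor becomes the block in block
  row \<open>(t, i)\<close>, so it is labelled by the target of the move. With this choice the
  product of block matrices reproduces the wreath product multiplication, including the inverse in
  its action.\<close>

definition to_Aut where
  "to_Aut w = (blk (perm w) (lmat w), blk (perm w) (rmat w))"

lemma B_carrier: "t \<in> {1..s} \<Longrightarrow> B t \<in> carrier_mat (dim_row (B t)) (dim_row (B t))"
  using primitive int_weighing_mat_carrier by (auto simp: primitive_int_weighing_mat_def)

lemma C_carrier: "k \<in> K \<Longrightarrow> C k \<in> carrier_mat (d k) (d k)"
  using B_carrier by (cases k) auto

lemma W_D:
  assumes "w \<in> carrier W" "t \<in> {1..s}"
  shows "snd (w t) permutes {1..r t}"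
    and "i \<in> {1..r t} \<Longrightarrow> fst (w t) i \<in> carrier (Aut_mat (B t))"
proof -
  have "w t \<in> carrier (wreath_sym (Aut_mat (B t)) (r t))" using assms by (auto simp: PiE_iff)
  then show "snd (w t) permutes {1..r t}"
    and "i \<in> {1..r t} \<Longrightarrow> fst (w t) i \<in> carrier (Aut_mat (B t))"
    by (auto simp: carrier_wreath_sym)
qed

text \<open>Outside the index ranges both sides take their default value: tuples are
  \<open>undefined\<close> and permutations fix the argument.\<close>

lemma W_eqI:
  assumes w: "w \<in> carrier W" and w': "w' \<in> carrier W"
    and eq: "\<And>t i. t \<in> {1..s} \<Longrightarrow> i \<in> {1..r t} \<Longrightarrow> fst (w t) i = fst (w' t) i \<and> snd (w t) i = snd (w' t) i"
  shows "w = w'"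
proof (rule PiE_ext)
  show "w \<in> (\<Pi>\<^sub>E t\<in>{1..s}. carrier (wreath_sym (Aut_mat (B t)) (r t)))"
    "w' \<in> (\<Pi>\<^sub>E t\<in>{1..s}. carrier (wreath_sym (Aut_mat (B t)) (r t)))"
    using w w' by simp_all
  fix t assume t: "t \<in> {1..s}"
  have "w t \<in> carrier (wreath_sym (Aut_mat (B t)) (r t))"
    "w' t \<in> carrier (wreath_sym (Aut_mat (B t)) (r t))" using w w' t by (auto simp: PiE_iff)
  then have "fst (w t) \<in> {1..r t} \<rightarrow>\<^sub>E carrier (Aut_mat (B t))"
    "fst (w' t) \<in> {1..r t} \<rightarrow>\<^sub>E carrier (Aut_mat (B t))"
    by (auto simp: carrier_wreath_sym)
  then have "fst (w t) = fst (w' t)" by (rule PiE_ext) (use eq[OF t] in blast)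
  moreover have "snd (w t) = snd (w' t)"
  proof
    fix i show "snd (w t) i = snd (w' t) i"
      using eq[OF t, of i] permutes_not_in[OF W_D(1)[OF w t], of i]
        permutes_not_in[OF W_D(1)[OF w' t], of i] by (cases "i \<in> {1..r t}") auto
  qed
  ultimately show "w t = w' t" by (rule prod_eqI)
qed

lemma perm_permutes:
  assumes w: "w \<in> carrier W"
  shows "perm w permutes K"
proof (rule bij_imp_permutes)
  note \<sigma> = W_D(1)[OF w]
  have *: "inv' (snd (w t)) i \<in> {1..r t}" "snd (w t) i \<in> {1..r t}"
    if "t \<in> {1..s}" "i \<in> {1..r t}" for t i
    using that(2) by (simp_all only: permutes_in_image[OF permutes_inv[OF \<sigma>[OF that(1)]]]
        permutes_in_image[OF \<sigma>[OF that(1)]])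
  show "bij_betw (perm w) K K"
    by (rule bij_betw_byWitness[where f' = "\<lambda>(t, i). (t, inv' (snd (w t)) i)"])
      (use * permutes_inverses[OF \<sigma>] in \<open>auto simp: perm_def\<close>)
  fix k assume "k \<notin> K"
  then show "perm w k = k"
    by (cases k) (auto simp: perm_def intro!: permutes_not_in[OF \<sigma>])
qed

lemma d_perm: "d (perm w k) = d k"
  by (auto simp: perm_def split: prod.splits)

lemma inv_perm:
  assumes w: "w \<in> carrier W" and t: "t \<in> {1..s}"
  shows "inv' (perm w) (t, i) = (t, inv' (snd (w t)) i)"
  using permutes_inv_eq[OF perm_permutes[OF w]] permutes_inverses(1)[OF W_D(1)[OF w t]] t
  by (auto simp: perm_def)

lemma lmat_rmat:
  assumes w: "w \<in> carrier W" and k: "k \<in> K"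
  shows "lmat w k \<in> Mon (d k)" "rmat w k \<in> Mon (d k)" "lmat w k * C k * (rmat w k)\<^sup>T = C k"
proof -
  obtain t i where ti: "k = (t, i)" "t \<in> {1..s}" "i \<in> {1..r t}" using k by auto
  have "(lmat w k, rmat w k) \<in> carrier (Aut_mat (B t))"
    using W_D(2)[OF w ti(2,3)] by (simp add: ti(1) lmat_def rmat_def)
  then show "lmat w k \<in> Mon (d k)" "rmat w k \<in> Mon (d k)" "lmat w k * C k * (rmat w k)\<^sup>T = C k"
    using carrier_Aut_mat[OF B_carrier[OF ti(2)]] ti(1) by auto
qed

lemma lmat_rmat_carrier:
  assumes w: "w \<in> carrier W" and k: "k \<in> K"
  shows "lmat w k \<in> carrier_mat (d k) (d k)" "rmat w k \<in> carrier_mat (d k) (d k)"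
  using lmat_rmat[OF assms] Mon_carrier by auto

section \<open>The isomorphism onto the automorphisms of the direct sum\<close>

lemma to_Aut_in_carrier:
  assumes w: "w \<in> carrier W"
  shows "to_Aut w \<in> carrier (Aut_mat (blk id C))"
proof -
  note p = perm_permutes[OF w]
  have "blk (perm w) (lmat w) \<in> Mon n" "blk (perm w) (rmat w) \<in> Mon n"
    using blk_in_Mon_iff[OF p d_perm lmat_rmat_carrier(1)[OF w]]
      blk_in_Mon_iff[OF p d_perm lmat_rmat_carrier(2)[OF w]] lmat_rmat[OF w] by blast+
  moreover have "blk (perm w) (lmat w) * blk id C * (blk (perm w) (rmat w))\<^sup>T =
      blk id (\<lambda>k. lmat w k * C (inv' (perm w) k) * (rmat w k)\<^sup>T)"
    by (rule blk_sandwich[OF p d_perm lmat_rmat_carrier[OF w] C_carrier])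
  moreover have "\<dots> = blk id C"
  proof (rule blk_cong)
    fix k assume k: "k \<in> K"
    \<comment> \<open>\<open>perm w\<close> keeps the first component, so the block arriving at
      \<open>k\<close> is a copy of the same \<open>B t\<close>.\<close>
    then have "C (inv' (perm w) k) = C k" by (auto simp: inv_perm[OF w])
    then show "lmat w k * C (inv' (perm w) k) * (rmat w k)\<^sup>T = C k" using lmat_rmat(3)[OF w k] by simp
  qed simp
  ultimately show ?thesis by (simp only: to_Aut_def carrier_Aut_mat[OF blk_carrier])
qed

lemma to_Aut_mult:
  assumes w: "w \<in> carrier W" and w': "w' \<in> carrier W"
  shows "to_Aut (w \<otimes>\<^bsub>W\<^esub> w') = to_Aut w \<otimes>\<^bsub>Aut_mat (blk id C)\<^esub> to_Aut w'"
proof -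
  have mult: "(w \<otimes>\<^bsub>W\<^esub> w') t = w t \<otimes>\<^bsub>wreath_sym (Aut_mat (B t)) (r t)\<^esub> w' t" if "t \<in> {1..s}" for t
    using that by simp
  have perm: "perm (w \<otimes>\<^bsub>W\<^esub> w') k = (perm w \<circ> perm w') k" if "k \<in> K" for k
    using that by (cases k) (auto simp: perm_def mult_wreath_sym)
  have fst: "fst ((w \<otimes>\<^bsub>W\<^esub> w') t) i = fst (w t) i \<otimes>\<^bsub>Aut_mat (B t)\<^esub> fst (w' t) (inv' (snd (w t)) i)"
    if "t \<in> {1..s}" "i \<in> {1..r t}" for t i
    using that by (simp add: mult mult_wreath_sym)
  have l: "lmat (w \<otimes>\<^bsub>W\<^esub> w') k = lmat w k * lmat w' (inv' (perm w) k)" if k: "k \<in> K" for k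
  proof -
    obtain t i where ti: "k = (t, i)" "t \<in> {1..s}" "i \<in> {1..r t}" using k by auto
    show ?thesis
      unfolding ti(1) inv_perm[OF w ti(2)] lmat_def prod.case fst[OF ti(2,3)] mult_Aut_mat by simp
  qed
  have r: "rmat (w \<otimes>\<^bsub>W\<^esub> w') k = rmat w k * rmat w' (inv' (perm w) k)" if k: "k \<in> K" for k
  proof -
    obtain t i where ti: "k = (t, i)" "t \<in> {1..s}" "i \<in> {1..r t}" using k by auto
    show ?thesis
      unfolding ti(1) inv_perm[OF w ti(2)] rmat_def prod.case fst[OF ti(2,3)] mult_Aut_mat by simp
  qed
  have "blk (perm w) (lmat w) * blk (perm w') (lmat w') = blk (perm (w \<otimes>\<^bsub>W\<^esub> w')) (lmat (w \<otimes>\<^bsub>W\<^esub> w'))"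
  proof -
    have "blk (perm w) (lmat w) * blk (perm w') (lmat w') =
        blk (perm w \<circ> perm w') (\<lambda>k. lmat w k * lmat w' (inv' (perm w) k))"
      by (rule blk_mult[OF perm_permutes[OF w] perm_permutes[OF w'] d_perm
            lmat_rmat_carrier(1)[OF w] lmat_rmat_carrier(1)[OF w'] d_perm])
    also have "\<dots> = blk (perm (w \<otimes>\<^bsub>W\<^esub> w')) (lmat (w \<otimes>\<^bsub>W\<^esub> w'))"
      by (rule blk_cong[OF perm[symmetric] l[symmetric]])
    finally show ?thesis .
  qed
  moreover have "blk (perm w) (rmat w) * blk (perm w') (rmat w') = blk (perm (w \<otimes>\<^bsub>W\<^esub> w')) (rmat (w \<otimes>\<^bsub>W\<^esub> w'))"
  proof -
    have "blk (perm w) (rmat w) * blk (perm w') (rmat w') =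
        blk (perm w \<circ> perm w') (\<lambda>k. rmat w k * rmat w' (inv' (perm w) k))"
      by (rule blk_mult[OF perm_permutes[OF w] perm_permutes[OF w'] d_perm
            lmat_rmat_carrier(2)[OF w] lmat_rmat_carrier(2)[OF w'] d_perm])
    also have "\<dots> = blk (perm (w \<otimes>\<^bsub>W\<^esub> w')) (rmat (w \<otimes>\<^bsub>W\<^esub> w'))"
      by (rule blk_cong[OF perm[symmetric] r[symmetric]])
    finally show ?thesis .
  qed
  ultimately show ?thesis by (simp only: to_Aut_def mult_Aut_mat fst_conv snd_conv)
qed

lemma inj_on_to_Aut: "inj_on to_Aut (carrier W)"
proof (rule inj_onI)
  fix w w' assume w: "w \<in> carrier W" and w': "w' \<in> carrier W" and eq: "to_Aut w = to_Aut w'"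
  have eqs: "blk (perm w) (lmat w) = blk (perm w') (lmat w')"
    "blk (perm w) (rmat w) = blk (perm w') (rmat w')"
    using eq by (simp_all add: to_Aut_def)
  show "w = w'"
  proof (rule W_eqI[OF w w'])
    fix t i assume t: "t \<in> {1..s}" and i: "i \<in> {1..r t}"
    have k: "(t, i) \<in> K" using t i by simp
    note inj = blk_inject[OF eqs(1) perm_permutes[OF w] d_perm lmat_rmat(1)[OF w] lmat_rmat(1)[OF w'] k]
      blk_inject[OF eqs(2) perm_permutes[OF w] d_perm lmat_rmat(2)[OF w] lmat_rmat(2)[OF w'] k]
    have "snd (w t) i = snd (w' t) i" using inj(1) t by (simp add: perm_def)
    moreover have "fst (w t) i = fst (w' t) i"
      using inj(2,4) by (auto simp: lmat_def rmat_def intro: prod_eqI)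
    ultimately show "fst (w t) i = fst (w' t) i \<and> snd (w t) i = snd (w' t) i" by simp
  qed
qed

lemma to_Aut_surj:
  assumes x: "x \<in> carrier (Aut_mat (blk id C))"
  shows "\<exists>w\<in>carrier W. to_Aut w = x"
proof -
  obtain L R where LR: "x = (L, R)" "L \<in> Mon n" "R \<in> Mon n" "L * blk id C * R\<^sup>T = blk id C"
    using x carrier_Aut_mat[OF blk_carrier] by (cases x) auto
  have prim: "primitive_int_weighing_mat (C k)" if "k \<in> K" for k
    using that primitive by (cases k) auto
  obtain \<tau> X Y where \<tau>: "\<tau> permutes K" and d: "\<And>k. k \<in> K \<Longrightarrow> d (\<tau> k) = d k"
    and X: "\<And>k. k \<in> K \<Longrightarrow> X k \<in> carrier_mat (d k) (d k)"
    and Y: "\<And>k. k \<in> K \<Longrightarrow> Y k \<in> carrier_mat (d k) (d k)"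
    and L: "L = blk \<tau> X" and R: "R = blk \<tau> Y"
    by (rule automorphism_block_form[OF prim C_carrier LR(2-4)]) blast+
  have XM: "X k \<in> Mon (d k)" and YM: "Y k \<in> Mon (d k)" if "k \<in> K" for k
    using blk_in_Mon_iff[OF \<tau> d X] blk_in_Mon_iff[OF \<tau> d Y] LR(2,3) L R that by auto
  have XCY: "X k * C (inv' \<tau> k) * (Y k)\<^sup>T = C k" if k: "k \<in> K" for k
  proof -
    let ?Z = "\<lambda>k. X k * C (inv' \<tau> k) * (Y k)\<^sup>T"
    have eq: "blk id ?Z = blk id C"
      using blk_sandwich[OF \<tau> d X Y C_carrier] LR(4) L R by simp
    have "C (inv' \<tau> k) \<in> carrier_mat (d k) (d k)"
      using C_carrier[OF inv_size_preserving(1)[OF \<tau> d k]] inv_size_preserving(2)[OF \<tau> d k] by simp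
    then have "?Z k \<in> carrier_mat (d k) (d k)"
      using X[OF k] Y[OF k] by auto
    from blk_id_inject[where X = ?Z, OF eq k this C_carrier[OF k]] show ?thesis .
  qed
  have fst_inv: "fst (inv' \<tau> k) = fst k" if k: "k \<in> K" for k
  proof (rule ccontr)
    assume ne: "fst (inv' \<tau> k) \<noteq> fst k"
    have k': "inv' \<tau> k \<in> K" "d (inv' \<tau> k) = d k"
      using inv_size_preserving[OF \<tau> d k] by simp_all
    have "C (inv' \<tau> k) \<sim>\<^sub>H C k"
      using XM[OF k] YM[OF k] XCY[OF k, symmetric] C_carrier[OF k'(1)]
      unfolding H_equiv_def k'(2) by (metis carrier_matD)
    then show False using inequivalent[OF _ _ ne] k k' by (auto split: prod.splits)
  qed
  \<comment> \<open>Using \<open>fst_inv\<close> at the image \<open>\<tau> (t, i)\<close> turns the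
    statement about the inverse into one about \<open>\<tau>\<close>, which therefore splits into
    one permutation of copies for each \<open>t\<close>.\<close>
  have \<tau>_eq: "\<tau> (t, i) = (t, snd (\<tau> (t, i)))" if "(t, i) \<in> K" for t i
  proof -
    have "\<tau> (t, i) \<in> K" using that \<tau> by (simp only: permutes_in_image)
    from fst_inv[OF this] show ?thesis
      using \<tau> by (simp add: permutes_inverses prod_eq_iff)
  qed
  define \<sigma> where "\<sigma> t i = (if i \<in> {1..r t} then snd (\<tau> (t, i)) else i)" for t i
  have \<sigma>: "\<sigma> t permutes {1..r t}" if t: "t \<in> {1..s}" for t
  proof (rule bij_imp_permutes)
    have "\<sigma> t ` {1..r t} \<subseteq> {1..r t}"
    proof
      fix j assume "j \<in> \<sigma> t ` {1..r t}"
      then obtain i where i: "i \<in> {1..r t}" "j = snd (\<tau> (t, i))" by (auto simp: \<sigma>_def)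
      then have "(t, i) \<in> K" using t by simp
      then have "\<tau> (t, i) \<in> K" "\<tau> (t, i) = (t, j)"
        using \<tau> \<tau>_eq[of t i] i by (simp_all only: permutes_in_image)
      then show "j \<in> {1..r t}" by auto
    qed
    moreover have "inj_on (\<sigma> t) {1..r t}"
    proof (rule inj_onI)
      fix i j assume ij: "i \<in> {1..r t}" "j \<in> {1..r t}" "\<sigma> t i = \<sigma> t j"
      then have "(t, i) \<in> K" "(t, j) \<in> K" "snd (\<tau> (t, i)) = snd (\<tau> (t, j))"
        using t by (auto simp: \<sigma>_def)
      then have "\<tau> (t, i) = \<tau> (t, j)" using \<tau>_eq by metis
      then show "i = j" using permutes_inj[OF \<tau>] by (auto dest: injD)
    qed
    ultimately show "bij_betw (\<sigma> t) {1..r t} {1..r t}"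
      by (simp add: bij_betw_def endo_inj_surj)
  qed (auto simp: \<sigma>_def)
  \<comment> \<open>Restriction gives \<open>undefined\<close> outside the index sets, as the
    carriers of \<open>W\<close> and of the tuples demand; \<open>\<sigma> t\<close>, being a
    permutation, is the identity there instead.\<close>
  define w where "w = (\<lambda>t\<in>{1..s}. (\<lambda>i\<in>{1..r t}. (X (t, i), Y (t, i)), \<sigma> t))"
  have "w t \<in> carrier (wreath_sym (Aut_mat (B t)) (r t))" if t: "t \<in> {1..s}" for t
  proof -
    have "(X (t, i), Y (t, i)) \<in> carrier (Aut_mat (B t))" if i: "i \<in> {1..r t}" for i
    proof -
      have k: "(t, i) \<in> K" using t i by simp
      have "C (inv' \<tau> (t, i)) = B t" using fst_inv[OF k] by (auto split: prod.splits)
      then show ?thesis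
        using XCY[OF k] XM[OF k] YM[OF k] carrier_Aut_mat[OF B_carrier[OF t]] by simp
    qed
    then show ?thesis using t \<sigma> by (simp add: w_def carrier_wreath_sym)
  qed
  then have "w \<in> carrier W" by (auto simp: w_def)
  moreover have "to_Aut w = x"
  proof -
    have "perm w k = \<tau> k" "lmat w k = X k" "rmat w k = Y k" if "k \<in> K" for k
      using that \<tau>_eq[of "fst k" "snd k"]
      by (auto simp: perm_def lmat_def rmat_def w_def \<sigma>_def)
    then have "blk (perm w) (lmat w) = L" "blk (perm w) (rmat w) = R"
      unfolding L R by (intro blk_cong; simp only:)+
    then show ?thesis by (simp only: to_Aut_def LR(1))
  qed
  ultimately show ?thesis by blast
qed

lemma W_mult_closed:
  assumes w: "w \<in> carrier W" and w': "w' \<in> carrier W"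
  shows "w \<otimes>\<^bsub>W\<^esub> w' \<in> carrier W"
proof -
  have "w t \<otimes>\<^bsub>wreath_sym (Aut_mat (B t)) (r t)\<^esub> w' t \<in> carrier (wreath_sym (Aut_mat (B t)) (r t))"
    if t: "t \<in> {1..s}" for t
    by (rule wreath_sym_mult_closed[OF Aut_mat_mult_closed[OF B_carrier[OF t]]])
      (use w w' t in \<open>auto simp: PiE_iff\<close>)
  then show ?thesis by simp
qed

lemma Aut_mat_blk_iso: "Aut_mat (blk id C) \<cong> W"
proof (rule iso_inv_of_mult_closed)
  have "bij_betw to_Aut (carrier W) (carrier (Aut_mat (blk id C)))"
    using inj_on_to_Aut to_Aut_in_carrier to_Aut_surj by (force simp only: bij_betw_def)
  then show "to_Aut \<in> iso W (Aut_mat (blk id C))"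
    using to_Aut_in_carrier to_Aut_mult by (simp only: iso_def hom_def) blast
qed (rule W_mult_closed)

end

theorem theorem4p8:
  fixes A :: "int mat" and B :: "nat \<Rightarrow> int mat" and r :: "nat \<Rightarrow> nat" and s :: nat
  assumes "int_weighing_mat A"
    and "A \<sim>\<^sub>H diag_block_mat (concat (map (\<lambda>t. replicate (r t) (B t)) [1..<Suc s]))"
    and "\<forall>t\<in>{1..s}. primitive_int_weighing_mat (B t)"
    and "\<forall>i\<in>{1..s}. \<forall>j\<in>{1..s}. i \<noteq> j \<longrightarrow> \<not> B i \<sim>\<^sub>H B j"
  shows "Aut_mat A \<cong> product_group {1..s} (\<lambda>t. wreath_sym (Aut_mat (B t)) (r t)) \<and>
    order (Aut_mat A) = (\<Prod>t = 1..s. order (Aut_mat (B t)) ^ r t * fact (r t))"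
proof -
  let ?K = "SIGMA t:{1..s}. {1..r t}" and ?d = "\<lambda>(t, i :: nat). dim_row (B t)"
    and ?C = "\<lambda>(t, i :: nat). B t"
    and ?W = "product_group {1..s} (\<lambda>t. wreath_sym (Aut_mat (B t)) (r t))"
  \<comment> \<open>The labels come in the order in which the direct sum lists its blocks, so
    mapping \<open>?C\<close> over \<open>ks\<close> returns the given list. For
    \<open>r t = 0\<close> no label has first component \<open>t\<close>, and the corresponding
    wreath product has one element.\<close>
  define ks where "ks = concat (map (\<lambda>t. map (Pair t) [1..<Suc (r t)]) [1..<Suc s])"
  define D where "D = diag_block_mat (map ?C ks)"
  define n where "n = sum_list (map ?d ks)"
  have set_ks: "set ks = ?K" by (auto simp: ks_def image_iff simp del: upt_Suc)
  have "distinct ks" unfolding ks_def by (intro distinct_concat_Pair distinct_upt)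
  have B: "B t \<in> carrier_mat (dim_row (B t)) (dim_row (B t)) \<and> 0 < dim_row (B t)" if "t \<in> {1..s}" for t
    using assms(3) that int_weighing_mat_carrier by (auto simp: primitive_int_weighing_mat_def)
  have C: "?C k \<in> carrier_mat (?d k) (?d k)" if "k \<in> set ks" for k
    using B that unfolding set_ks by (cases k) auto
  obtain e where e: "bij_betw e (SIGMA k:?K. {..<?d k}) {..<n}"
    and De: "\<forall>k\<in>?K. \<forall>l\<in>?K. \<forall>a<?d k. \<forall>b<?d l.
       D $$ (e (k, a), e (l, b)) = (if k = l then ?C k $$ (a, b) else 0)"
    using diag_block_mat_reindex[where C = ?C and d = ?d, OF \<open>distinct ks\<close> C]
    unfolding set_ks D_def n_def by blast
  interpret primitive_block_sum B r s e n
  proof unfold_locales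
    show "finite ?K" by blast
    show "bij_betw e (SIGMA k:?K. {..<?d k}) {..<n}" by (rule e)
    show "0 < ?d k" if "k \<in> ?K" for k using that B[of "fst k"] by (cases k) simp
    show "primitive_int_weighing_mat (B t)" if "t \<in> {1..s}" for t using that assms(3) by blast
    show "\<not> B t \<sim>\<^sub>H B t'" if "t \<in> {1..s}" "t' \<in> {1..s}" "t \<noteq> t'" for t t'
      using that assms(4) by blast
  qed
  have dims: "map dim_row (map ?C ks) = map ?d ks" "map dim_col (map ?C ks) = map ?d ks"
    unfolding map_map
    by (rule map_cong[OF refl], simp only: o_apply carrier_matD[OF C])+
  have "D \<in> carrier_mat n n"
    using dims by (auto simp only: D_def n_def dim_diag_block_mat carrier_mat_def)
  \<comment> \<open>The given direct sum is the block matrix with trivial permutation, to which the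
    results on automorphisms apply.\<close>
  then have D: "D = blk id ?C"
  proof (rule mat_eqI)
    fix k l :: "nat \<times> nat" and a b :: nat
    assume ka: "(k, a) \<in> (SIGMA k:?K. {..<?d k})" and lb: "(l, b) \<in> (SIGMA k:?K. {..<?d k})"
    then have "k \<in> ?K" "l \<in> ?K" "a < ?d k" "b < ?d l" by (simp_all only: mem_Sigma_iff lessThan_iff)
    then show "D $$ (e (k, a), e (l, b)) = blk id ?C $$ (e (k, a), e (l, b))"
      unfolding blk_index[OF ka lb] id_apply using De by blast
  qed (rule blk_carrier)
  have "map ?C ks = concat (map (\<lambda>t. replicate (r t) (B t)) [1..<Suc s])"
    by (simp add: ks_def map_concat o_def map_replicate_const del: upt_Suc)
  then have "A \<sim>\<^sub>H D" using assms(2) by (simp add: D_def)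
  then have "Aut_mat A \<cong> Aut_mat D"
    using Aut_mat_H_equiv int_weighing_mat_carrier[OF assms(1)] by blast
  then have iso: "Aut_mat A \<cong> ?W"
    using Aut_mat_blk_iso iso_trans unfolding D by blast
  then have "order (Aut_mat A) = order ?W"
    by (auto simp: is_iso_def iso_def order_def dest: bij_betw_same_card)
  also have "\<dots> = (\<Prod>t = 1..s. order (wreath_sym (Aut_mat (B t)) (r t)))"
    by (simp add: order_def card_PiE)
  finally show ?thesis using iso by (simp add: order_wreath_sym)
qed

end
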